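(* Let $n\geqslant1$ be an integer and $s\in(0,1)$. There exist a bounded open set $\Omega\subset\mathbb{R}^n_+$ and a set $\Omega'\subset\subset\Omega$ such that, for all $C>0$, there exists an $x_1$-antisymmetric function $u:\mathbb{R}^n\to\mathbb{R}$ that is non-negative and $s$-harmonic in $\Omega$, and $$\sup_{\Omega'}u>C\inf_{\Omega'}u .$$
   Context: $\mathbb{R}^n_+=\{x\in\mathbb{R}^n : x_1>0\}$. $\Omega'\subset\subset\Omega$ means that $\overline{\Omega'}$ is compact and contained in $\Omega$. For $s\in(0,1)$ the fractional Laplacian is $$(-\Delta)^s u(x)=c_{n,s}\,\mathrm{P.V.}\int_{\mathbb{R}^n}\frac{u(x)-u(y)}{|x-y|^{n+2s}}\,dy,$$ where P.V. is the Cauchy principal value (limit as $\varepsilon\to0^+$ of the integral over $\mathbb{R}^n\setminus B_\varepsilon(x)$) and $c_{n,s}=\frac{s4^s\Gamma(\frac{n+2s}{2})}{\Gamma(1-s)}>0$ is a normalisation constant. A (measurable) function $u$ is $s$-harmonic in an open set $U$ if $(-\Delta)^su$ is well defined and equal to $0$ at every point of $U$. A function $u:\mathbb{R}^n\to\mathbb{R}$ is $x_1$-antisymmetric if $u(-x_1,x_2,\dots,x_n)=-u(x_1,x_2,\dots,x_n)$ for all $x\in\mathbb{R}^n$. *)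

theory Defs
  imports "HOL-Analysis.Analysis"
begin

text \<open>Points of $\mathbb{R}^n$ are vectors of type \<^typ>\<open>real ^ 'n\<close> with $n$ = \<^term>\<open>CARD('n)\<close>.
  A finite index type has no canonical first element, so an index \<open>k\<close> is passed explicitly and
  plays the role of the first coordinate.\<close>

definition half_space :: "'n::finite \<Rightarrow> (real ^ 'n) set" where
  "half_space k = {x. x $ k > 0}"

definition reflect :: "'n::finite \<Rightarrow> real ^ 'n \<Rightarrow> real ^ 'n" where
  "reflect k x = (\<chi> i. if i = k then - (x $ i) else x $ i)"

definition antisymmetric :: "'n::finite \<Rightarrow> (real ^ 'n \<Rightarrow> real) \<Rightarrow> bool" where
  "antisymmetric k u \<longleftrightarrow> (\<forall>x. u (reflect k x) = - u x)"

definition compactly_contained :: "'a::topological_space set \<Rightarrow> 'a set \<Rightarrow> bool" where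
  "compactly_contained A U \<longleftrightarrow> compact (closure A) \<and> closure A \<subseteq> U"

definition frac_laplacian_const :: "nat \<Rightarrow> real \<Rightarrow> real" where
  "frac_laplacian_const n s = s * 4 powr s * Gamma ((real n + 2 * s) / 2) / Gamma (1 - s)"

definition frac_kernel :: "real \<Rightarrow> (real ^ 'n::finite \<Rightarrow> real) \<Rightarrow> real ^ 'n \<Rightarrow> real ^ 'n \<Rightarrow> real" where
  "frac_kernel s u x y = (u x - u y) / norm (x - y) powr (real CARD('n) + 2 * s)"

definition truncated_integral :: "real \<Rightarrow> (real ^ 'n::finite \<Rightarrow> real) \<Rightarrow> real ^ 'n \<Rightarrow> real \<Rightarrow> real" where
  "truncated_integral s u x \<epsilon> = (LINT y : (- ball x \<epsilon>) | lebesgue. frac_kernel s u x y)"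

text \<open>Both Lebesgue integrals and limits are total in HOL, so well-definedness of the principal
  value is stated separately: every truncated integral converges absolutely, and the truncated
  integrals have a finite limit.\<close>

definition frac_laplacian_defined :: "real \<Rightarrow> (real ^ 'n::finite \<Rightarrow> real) \<Rightarrow> real ^ 'n \<Rightarrow> bool" where
  "frac_laplacian_defined s u x \<longleftrightarrow>
     (\<forall>\<epsilon>>0. set_integrable lebesgue (- ball x \<epsilon>) (frac_kernel s u x)) \<and>
     (\<exists>l. (truncated_integral s u x \<longlongrightarrow> l) (at_right 0))"

definition frac_laplacian :: "real \<Rightarrow> (real ^ 'n::finite \<Rightarrow> real) \<Rightarrow> real ^ 'n \<Rightarrow> real" where
  "frac_laplacian s u x =
     frac_laplacian_const CARD('n) s * Lim (at_right 0) (truncated_integral s u x)"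

definition s_harmonic_on :: "real \<Rightarrow> (real ^ 'n::finite) set \<Rightarrow> (real ^ 'n \<Rightarrow> real) \<Rightarrow> bool" where
  "s_harmonic_on s U u \<longleftrightarrow>
     u \<in> borel_measurable lebesgue \<and>
     (\<forall>x\<in>U. frac_laplacian_defined s u x \<and> frac_laplacian s u x = 0)"

end

theory Submission
  imports Defs
begin

text \<open>A Harnack inequality fails as soon as some $u \ge 0$ has $\inf_{\Omega'} u = 0 < \sup_{\Omega'} u$, and
then the same $u$ serves for every constant. An antisymmetric $u$ may be negative in the half space
outside $\Omega$, so nothing prevents an interior zero: it suffices that $u$ has a strict local
minimum of value zero along $x_1$. The proof builds such a $u$ as a function of $x_1$ alone.

The building blocks are the functions $(p + v \cdot y)_+^s$, which are $s$-harmonic where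
$p + v \cdot y > 0$ (\<open>principal_value_zero_pos_power\<close>). On the line this comes from an explicit
primitive: after the reflection $t = -r$ for $t < 0$ and the inversion $t = r/(1-r)$ for $t > 0$, the
two halves of the principal value combine into the derivative of
$-(1-(1-r)^s)^2 r^{-2s}/(2s)$ (\<open>integral_pos_power_kernel_bound\<close>).

The passage from the line to $\mathbb{R}^n$ needs that the truncation by a ball restricts, on each line
through the centre, to a truncation by an interval. Instead of polar coordinates, the integral over
$\mathbb{R}^n$ is averaged over the dilations of an annulus (\<open>integral_dilations\<close>), which uses only
Tonelli's theorem and the scaling of Lebesgue measure.

For $b > 1$ the odd function $(b+t)_+^s - (b-t)_+^s$ yields an antisymmetric function, $s$-harmonic in the
strip $|y_1| < b$. As $b \to 1^+$ its second derivative at $t = 1$ outgrows its first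
derivative, and that outgrows its value. So three such functions have a combination whose
value and slope at $1$ vanish and whose second derivative there is positive
(\<open>odd_power_combination\<close>). A small ball about the first unit vector is then a valid $\Omega$.\<close>

section \<open>Integration over dilations of an annulus\<close>

lemma nn_integral_even:
  fixes f :: "real \<Rightarrow> ennreal"
  assumes [measurable]: "f \<in> borel_measurable borel"
  shows "(\<integral>\<^sup>+r. f \<bar>r\<bar> \<partial>lborel) = 2 * (\<integral>\<^sup>+r. f r * indicator {0<..} r \<partial>lborel)"
proof -
  have "(\<integral>\<^sup>+r. f \<bar>r\<bar> \<partial>lborel) =
      (\<integral>\<^sup>+r. f r * indicator {0<..} r + f (- r) * indicator {0<..} (- r) \<partial>lborel)"
    using AE_lborel_singleton[of "0::real"]
    by (intro nn_integral_cong_AE) (auto elim!: eventually_mono split: split_indicator simp: abs_if)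
  also have "\<dots> = (\<integral>\<^sup>+r. f r * indicator {0<..} r \<partial>lborel) +
      (\<integral>\<^sup>+r. f (- r) * indicator {0<..} (- r) \<partial>lborel)"
    by (intro nn_integral_add) auto
  also have "(\<integral>\<^sup>+r. f (- r) * indicator {0<..} (- r) \<partial>lborel) =
      (\<integral>\<^sup>+r. f r * indicator {0<..} r \<partial>lborel)"
    using nn_integral_real_affine[of "\<lambda>r. f r * indicator {0<..} r" "-1" 0] by simp
  finally show ?thesis by (simp add: mult_2)
qed

text \<open>The ratio of the radii is $e$, so that $\int_0^\infty 1_A(z/r)\,dr/r = \ln e = 1$ for every $z \ne 0$.\<close>

definition annulus :: "'a::real_normed_vector set" where
  "annulus = {w. 1 \<le> norm w \<and> norm w < exp 1}"

text \<open>The density that makes $(w, r) \mapsto r w$ cover every $z \ne 0$ with total mass 2, once for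
each sign of $r$: the Jacobian $|r|^n$ of the dilation times the invariant measure $dr/|r|$. Letting
$r$ run through both signs keeps the whole line through $0$ and $w$ together, as the cancellation in a
principal value requires.\<close>

definition dilation_weight :: "'a::euclidean_space \<Rightarrow> real \<Rightarrow> real" where
  "dilation_weight w r = indicator annulus w * \<bar>r\<bar> ^ DIM('a) / \<bar>r\<bar>"

lemma annulus_sets [measurable]: "annulus \<in> sets borel"
  unfolding annulus_def by measurable

lemma dilation_weight_measurable [measurable]:
  "(\<lambda>p. dilation_weight (f p) (g p)) \<in> borel_measurable M"
  if [measurable]: "f \<in> borel_measurable M" "g \<in> borel_measurable M"
  unfolding dilation_weight_def annulus_def by measurable

lemma dilation_weight_nonneg: "dilation_weight w r \<ge> 0"
  by (simp add: dilation_weight_def)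

lemma nn_integral_dilations_through_annulus:
  fixes z :: "'a::euclidean_space"
  assumes "z \<noteq> 0"
  shows "(\<integral>\<^sup>+r. ennreal (indicator annulus (z /\<^sub>R r) / \<bar>r\<bar>) \<partial>lborel) = 2"
proof -
  define \<rho> where "\<rho> = norm z"
  have \<rho>: "\<rho> > 0" using assms by (simp add: \<rho>_def)
  have "(\<integral>\<^sup>+r. ennreal (indicator annulus (z /\<^sub>R r) / \<bar>r\<bar>) \<partial>lborel) =
     (\<integral>\<^sup>+r. ennreal (1 / \<bar>r\<bar>) * indicator {\<rho> / exp 1<..\<rho>} \<bar>r\<bar> \<partial>lborel)"
  proof (intro nn_integral_cong)
    fix r :: real
    show "ennreal (indicator annulus (z /\<^sub>R r) / \<bar>r\<bar>) =
        ennreal (1 / \<bar>r\<bar>) * indicator {\<rho> / exp 1<..\<rho>} \<bar>r\<bar>"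
    proof (cases "r = 0")
      case False
      then have "z /\<^sub>R r \<in> annulus \<longleftrightarrow> \<bar>r\<bar> \<in> {\<rho> / exp 1<..\<rho>}"
        by (simp add: annulus_def \<rho>_def field_simps) (auto simp: divide_simps)
      then show ?thesis by (simp split: split_indicator)
    qed simp
  qed
  also have "\<dots> = 2 * (\<integral>\<^sup>+r. ennreal (1 / r) * indicator {\<rho> / exp 1<..\<rho>} r * indicator {0<..} r \<partial>lborel)"
    by (rule nn_integral_even) measurable
  also have "(\<integral>\<^sup>+r. ennreal (1 / r) * indicator {\<rho> / exp 1<..\<rho>} r * indicator {0<..} r \<partial>lborel) =
     (\<integral>\<^sup>+r. ennreal (1 / r) * indicator {\<rho> / exp 1..\<rho>} r \<partial>lborel)"
  proof (intro nn_integral_cong_AE eventually_mono[OF AE_lborel_singleton[of "\<rho> / exp 1"]])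
    fix r assume "r \<noteq> \<rho> / exp 1"
    moreover have "\<rho> / exp 1 > 0" using \<rho> by simp
    ultimately show "ennreal (1 / r) * indicator {\<rho> / exp 1<..\<rho>} r * indicator {0<..} r =
        ennreal (1 / r) * indicator {\<rho> / exp 1..\<rho>} r"
      by (auto split: split_indicator)
  qed
  also have "\<dots> = ln \<rho> - ln (\<rho> / exp 1)"
  proof (rule nn_integral_FTC_Icc[where F=ln])
    show "(\<lambda>r::real. 1 / r) \<in> borel_measurable borel" by measurable
    fix x assume "x \<in> {\<rho> / exp 1..\<rho>}"
    moreover have "\<rho> / exp 1 > 0" using \<rho> by simp
    ultimately have x: "x > 0" by (auto intro: less_le_trans)
    show "(ln has_real_derivative 1 / x) (at x)"
      by (rule DERIV_ln_divide[OF x])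
    show "0 \<le> 1 / x" using x by simp
  next
    show "\<rho> / exp 1 \<le> \<rho>" using \<rho> by (simp add: field_simps)
  qed
  also have "ln \<rho> - ln (\<rho> / exp 1) = 1" using \<rho> by (simp add: ln_div)
  finally show ?thesis by simp
qed

lemma nn_integral_dilate:
  fixes f :: "'a::euclidean_space \<Rightarrow> ennreal"
  assumes [measurable]: "f \<in> borel_measurable borel" and "r \<noteq> 0"
  shows "(\<integral>\<^sup>+z. f z \<partial>lborel) = (\<integral>\<^sup>+w. ennreal (\<bar>r\<bar> ^ DIM('a)) * f (r *\<^sub>R w) \<partial>lborel)"
  by (subst lborel_affine[OF assms(2), of 0])
    (simp add: nn_integral_density nn_integral_distr)

text \<open>Insert $2 = \int 1_A(z/r)\,dr/|r|$ under the integral over $z$, exchange the integrals, and substitute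
$z = r w$ for fixed $r$.\<close>

lemma nn_integral_dilations:
  fixes G :: "'a::euclidean_space \<Rightarrow> ennreal"
  assumes [measurable]: "G \<in> borel_measurable borel"
  shows "(\<integral>\<^sup>+(w, r). ennreal (dilation_weight w r) * G (r *\<^sub>R w) \<partial>(lborel \<Otimes>\<^sub>M lborel)) =
    2 * (\<integral>\<^sup>+z. G z \<partial>lborel)"
proof -
  have "(\<integral>\<^sup>+(w, r). ennreal (dilation_weight w r) * G (r *\<^sub>R w) \<partial>(lborel \<Otimes>\<^sub>M lborel)) =
      (\<integral>\<^sup>+r. (\<integral>\<^sup>+w. ennreal (dilation_weight w r) * G (r *\<^sub>R w) \<partial>lborel) \<partial>lborel)"
    by (subst lborel_pair.nn_integral_snd[symmetric]) auto
  also have "\<dots> = (\<integral>\<^sup>+r. (\<integral>\<^sup>+z. ennreal (indicator annulus (z /\<^sub>R r) / \<bar>r\<bar>) * G z \<partial>lborel) \<partial>lborel)"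
  proof (rule nn_integral_cong_AE, rule eventually_mono[OF AE_lborel_singleton[of 0]])
    fix r :: real assume r: "r \<noteq> 0"
    have "(\<integral>\<^sup>+w. ennreal (dilation_weight w r) * G (r *\<^sub>R w) \<partial>lborel) =
      (\<integral>\<^sup>+w. ennreal (\<bar>r\<bar> ^ DIM('a)) *
        (ennreal (indicator annulus (r *\<^sub>R w /\<^sub>R r) / \<bar>r\<bar>) * G (r *\<^sub>R w)) \<partial>lborel)"
    proof (intro nn_integral_cong)
      fix w :: 'a
      have "ennreal (dilation_weight w r) =
          ennreal (\<bar>r\<bar> ^ DIM('a)) * ennreal (indicator annulus w / \<bar>r\<bar>)"
        by (simp add: dilation_weight_def ennreal_mult[symmetric] mult.commute)
      then show "ennreal (dilation_weight w r) * G (r *\<^sub>R w) =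
          ennreal (\<bar>r\<bar> ^ DIM('a)) * (ennreal (indicator annulus (r *\<^sub>R w /\<^sub>R r) / \<bar>r\<bar>) * G (r *\<^sub>R w))"
        using r by (simp add: mult.assoc)
    qed
    also have "\<dots> = (\<integral>\<^sup>+z. ennreal (indicator annulus (z /\<^sub>R r) / \<bar>r\<bar>) * G z \<partial>lborel)"
      by (rule nn_integral_dilate[OF _ r, symmetric]) measurable
    finally show "(\<integral>\<^sup>+w. ennreal (dilation_weight w r) * G (r *\<^sub>R w) \<partial>lborel) =
      (\<integral>\<^sup>+z. ennreal (indicator annulus (z /\<^sub>R r) / \<bar>r\<bar>) * G z \<partial>lborel)" .
  qed
  also have "\<dots> = (\<integral>\<^sup>+z. (\<integral>\<^sup>+r. ennreal (indicator annulus (z /\<^sub>R r) / \<bar>r\<bar>) * G z \<partial>lborel) \<partial>lborel)"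
    by (rule lborel_pair.Fubini') measurable
  also have "\<dots> = (\<integral>\<^sup>+z. 2 * G z \<partial>lborel)"
  proof (rule nn_integral_cong_AE, rule eventually_mono[OF AE_lborel_singleton[of 0]])
    fix z :: 'a assume z: "z \<noteq> 0"
    show "(\<integral>\<^sup>+r. ennreal (indicator annulus (z /\<^sub>R r) / \<bar>r\<bar>) * G z \<partial>lborel) = 2 * G z"
      using nn_integral_dilations_through_annulus[OF z]
      by (subst nn_integral_multc) auto
  qed
  also have "\<dots> = 2 * (\<integral>\<^sup>+z. G z \<partial>lborel)" by (simp add: nn_integral_cmult)
  finally show ?thesis .
qed

text \<open>The same identity as an equality of measures, so that it transfers to integrals of signed functions.\<close>

lemma distr_dilations:
  "distr (density (lborel \<Otimes>\<^sub>M lborel) (\<lambda>(w, r). ennreal (dilation_weight w r))) borel (\<lambda>(w, r). r *\<^sub>R w)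
    = density lborel (\<lambda>_::'a::euclidean_space. 2)"
proof (rule measure_eqI)
  fix X :: "'a set" assume "X \<in> sets (distr (density (lborel \<Otimes>\<^sub>M lborel) (\<lambda>(w::'a, r). ennreal (dilation_weight w r))) borel (\<lambda>(w, r). r *\<^sub>R w))"
  then have [measurable]: "X \<in> sets borel" by simp
  show "emeasure (distr (density (lborel \<Otimes>\<^sub>M lborel) (\<lambda>(w::'a, r). ennreal (dilation_weight w r))) borel (\<lambda>(w, r). r *\<^sub>R w)) X
    = emeasure (density lborel (\<lambda>_. 2)) X"
    using nn_integral_dilations[of "indicator X"]
    by (simp add: nn_integral_indicator[symmetric] nn_integral_distr nn_integral_density split_beta' nn_integral_cmult
        del: nn_integral_indicator)
qed (simp only: sets_distr sets_density sets_lborel)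

lemma
  fixes G :: "'a::euclidean_space \<Rightarrow> real"
  assumes "integrable lborel G"
  shows integral_dilations:
      "2 * (\<integral>z. G z \<partial>lborel) = (\<integral>w. (\<integral>r. dilation_weight w r * G (r *\<^sub>R w) \<partial>lborel) \<partial>lborel)"
    and integrable_integral_dilations:
      "integrable lborel (\<lambda>w. (\<integral>r. dilation_weight w r * G (r *\<^sub>R w) \<partial>lborel))"
proof -
  have [measurable]: "G \<in> borel_measurable borel" using assms by auto
  let ?D = "density (lborel \<Otimes>\<^sub>M lborel) (\<lambda>p. ennreal (case p of (w::'a, r) \<Rightarrow> dilation_weight w r))"
  have D: "distr ?D borel (\<lambda>(w, r). r *\<^sub>R w) = density lborel (\<lambda>_::'a. ennreal 2)"
    using distr_dilations[where 'a='a] by (simp add: split_beta')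
  have "integrable (density lborel (\<lambda>_. ennreal 2)) G"
    using assms by (subst integrable_density) auto
  then have "integrable ?D (\<lambda>p. G (case p of (w, r) \<Rightarrow> r *\<^sub>R w))"
    unfolding D[symmetric] by (subst (asm) integrable_distr_eq) (auto simp: split_beta')
  then have int: "integrable (lborel \<Otimes>\<^sub>M lborel) (\<lambda>(w, r). dilation_weight w r * G (r *\<^sub>R w))"
    by (subst (asm) integrable_density) (auto simp: split_beta' dilation_weight_nonneg)
  have "2 * (\<integral>z. G z \<partial>lborel) = (\<integral>z. G z \<partial>density lborel (\<lambda>_. ennreal 2))"
    by (subst integral_density) auto
  also have "\<dots> = (\<integral>p. G (case p of (w, r) \<Rightarrow> r *\<^sub>R w) \<partial>?D)"
    unfolding D[symmetric] by (subst integral_distr) (auto simp: split_beta')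
  also have "\<dots> = (\<integral>(w, r). dilation_weight w r * G (r *\<^sub>R w) \<partial>(lborel \<Otimes>\<^sub>M lborel))"
    by (subst integral_density) (auto simp: split_beta' dilation_weight_nonneg)
  also have "\<dots> = (\<integral>w. (\<integral>r. dilation_weight w r * G (r *\<^sub>R w) \<partial>lborel) \<partial>lborel)"
    by (rule lborel_pair.integral_fst[OF int, symmetric])
  finally show "2 * (\<integral>z. G z \<partial>lborel) = (\<integral>w. (\<integral>r. dilation_weight w r * G (r *\<^sub>R w) \<partial>lborel) \<partial>lborel)" .
  show "integrable lborel (\<lambda>w. (\<integral>r. dilation_weight w r * G (r *\<^sub>R w) \<partial>lborel))"
    by (rule lborel_pair.integrable_fst[OF int])
qed

text \<open>The dilation formula bounds the integral by the volume of the annulus times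
$\int_{|r| \ge \epsilon/e} |r|^{-1-a}\,dr$, because $|w| \ge 1$ on the annulus.\<close>

lemma integrable_power_tail:
  fixes a \<epsilon> :: real
  assumes "a > 0" "\<epsilon> > 0"
  shows "integrable lborel (\<lambda>z::'a::euclidean_space. indicator (- ball 0 \<epsilon>) z * norm z powr (- real DIM('a) - a))"
proof -
  let ?G = "\<lambda>z::'a. indicator (- ball 0 \<epsilon>) z * norm z powr (- real DIM('a) - a)"
  define K where "K = 2 * (\<epsilon> / exp 1) powr - a / a"
  have "2 * (\<integral>\<^sup>+z. ennreal (?G z) \<partial>lborel) =
     (\<integral>\<^sup>+w. (\<integral>\<^sup>+r. ennreal (dilation_weight w r) * ennreal (?G (r *\<^sub>R w)) \<partial>lborel) \<partial>lborel)"
    by (subst nn_integral_dilations[symmetric]) (auto simp: lborel.nn_integral_fst[symmetric])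
  also have "\<dots> \<le> (\<integral>\<^sup>+w. ennreal K * indicator (annulus :: 'a set) w \<partial>lborel)"
  proof (intro nn_integral_mono)
    fix w :: 'a
    have "dilation_weight w r * ?G (r *\<^sub>R w) \<le>
        (\<bar>r\<bar> powr (-1 - a) * indicator {\<epsilon> / exp 1..} \<bar>r\<bar>) * indicator annulus w" for r
    proof (cases "w \<in> annulus \<and> r \<noteq> 0 \<and> r *\<^sub>R w \<notin> ball 0 \<epsilon>")
      case True
      then have w: "1 \<le> norm w" "norm w \<le> exp 1" and r: "\<bar>r\<bar> > 0" and e: "\<epsilon> \<le> \<bar>r\<bar> * norm w"
        by (auto simp: annulus_def)
      have "\<epsilon> \<le> \<bar>r\<bar> * exp 1" using e w(2) by (smt (verit) mult_left_mono)
      then have r2: "\<epsilon> / exp 1 \<le> \<bar>r\<bar>" by (simp add: field_simps)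
      have "norm w powr (- real DIM('a) - a) \<le> norm w powr 0"
        using w assms by (intro powr_mono) auto
      then have n1: "norm w powr (- real DIM('a) - a) \<le> 1" using w by (auto split: if_splits)
      have "\<bar>r\<bar> ^ DIM('a) / \<bar>r\<bar> * (\<bar>r\<bar> powr (- real DIM('a) - a) * norm w powr (- real DIM('a) - a))
         = (\<bar>r\<bar> powr DIM('a) / \<bar>r\<bar> powr 1 * \<bar>r\<bar> powr (- real DIM('a) - a)) * norm w powr (- real DIM('a) - a)"
        using r by (simp add: powr_realpow)
      also have "\<bar>r\<bar> powr DIM('a) / \<bar>r\<bar> powr 1 * \<bar>r\<bar> powr (- real DIM('a) - a) = \<bar>r\<bar> powr (-1 - a)"
        by (simp only: powr_diff[symmetric] powr_add[symmetric]) (simp add: algebra_simps)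
      also have "\<bar>r\<bar> powr (-1 - a) * norm w powr (- real DIM('a) - a) \<le> \<bar>r\<bar> powr (-1 - a) * 1"
        by (intro mult_left_mono n1) auto
      finally show ?thesis using True r2 w
        by (simp add: dilation_weight_def powr_mult)
    qed (auto simp: dilation_weight_def split: split_indicator)
    then have "(\<integral>\<^sup>+r. ennreal (dilation_weight w r) * ennreal (?G (r *\<^sub>R w)) \<partial>lborel) \<le>
      (\<integral>\<^sup>+r. ennreal (\<bar>r\<bar> powr (-1 - a)) * indicator {\<epsilon> / exp 1..} \<bar>r\<bar> * indicator annulus w \<partial>lborel)"
      by (intro nn_integral_mono) (auto simp: ennreal_mult[symmetric] dilation_weight_nonneg ennreal_indicator[symmetric] intro!: ennreal_leI simp del: ennreal_indicator)
    also have "\<dots> = (\<integral>\<^sup>+r. ennreal (\<bar>r\<bar> powr (-1 - a)) * indicator {\<epsilon> / exp 1..} \<bar>r\<bar> \<partial>lborel) * indicator annulus w"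
      by (subst nn_integral_multc) auto
    also have "(\<integral>\<^sup>+r. ennreal (\<bar>r\<bar> powr (-1 - a)) * indicator {\<epsilon> / exp 1..} \<bar>r\<bar> \<partial>lborel) =
       2 * (\<integral>\<^sup>+r. ennreal (r powr (-1 - a)) * indicator {\<epsilon> / exp 1..} r * indicator {0<..} r \<partial>lborel)"
      by (rule nn_integral_even) measurable
    also have "(\<integral>\<^sup>+r. ennreal (r powr (-1 - a)) * indicator {\<epsilon> / exp 1..} r * indicator {0<..} r \<partial>lborel) =
       (\<integral>\<^sup>+r. ennreal (r powr (-1 - a)) * indicator {\<epsilon> / exp 1..} r \<partial>lborel)"
    proof (intro nn_integral_cong)
      fix r :: real
      have "\<epsilon> / exp 1 > 0" using assms by simp
      then show "ennreal (r powr (-1 - a)) * indicator {\<epsilon> / exp 1..} r * indicator {0<..} r =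
        ennreal (r powr (-1 - a)) * indicator {\<epsilon> / exp 1..} r"
        by (auto split: split_indicator)
    qed
    also have "\<dots> = ennreal (0 - (- ((\<epsilon> / exp 1) powr - a / a)))"
    proof (rule nn_integral_FTC_atLeast)
      have "((\<lambda>r. r powr - a) \<longlongrightarrow> 0) at_top"
        using assms by (intro tendsto_neg_powr filterlim_ident) auto
      then have "((\<lambda>r. - (r powr - a / a)) \<longlongrightarrow> - (0 / a)) at_top"
        using assms by (intro tendsto_intros) auto
      then show "((\<lambda>r. - (r powr - a / a)) \<longlongrightarrow> 0) at_top" by simp
      fix x assume x: "\<epsilon> / exp 1 \<le> x"
      have "\<epsilon> / exp 1 > 0" using assms by simp
      with x have x: "x > 0" by simp
      show "DERIV (\<lambda>r. - (r powr - a / a)) x :> x powr (-1 - a)"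
        using x assms by (auto intro!: derivative_eq_intros simp: powr_diff powr_minus field_simps)
    qed auto
    also have "2 * ennreal (0 - (- ((\<epsilon> / exp 1) powr - a / a))) = ennreal K"
      using assms by (simp add: K_def ennreal_mult[symmetric] ennreal_numeral[symmetric] del: ennreal_numeral)
    finally show "(\<integral>\<^sup>+r. ennreal (dilation_weight w r) * ennreal (?G (r *\<^sub>R w)) \<partial>lborel) \<le> ennreal K * indicator annulus w" .
  qed
  also have "\<dots> = ennreal K * emeasure lborel (annulus :: 'a set)"
    by (simp add: nn_integral_cmult)
  also have "\<dots> \<le> ennreal K * emeasure lborel (cball 0 (exp 1) :: 'a set)"
    by (intro mult_left_mono emeasure_mono) (auto simp: annulus_def)
  also have "\<dots> < \<infinity>" using emeasure_lborel_cball_finite[of "0::'a" "exp 1"]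
    by (simp add: ennreal_mult_less_top)
  finally have "(\<integral>\<^sup>+z. ennreal (?G z) \<partial>lborel) < \<infinity>" by (auto simp: ennreal_mult_less_top)
  then show ?thesis by (intro integrableI_nonneg) auto
qed

section \<open>The power of the positive part on the line\<close>

definition pos_power :: "real \<Rightarrow> real \<Rightarrow> real" where
  "pos_power s t = max 0 t powr s"

lemma pos_power_measurable [measurable]: "pos_power s \<in> borel_measurable borel"
  unfolding pos_power_def by measurable

text \<open>Both terms lie between $0$ and $(c + |m|)^s$, and $c \le (c/\delta)\rho$. The bound is by the single power
$\rho^s$, so the kernel $\rho^{-n-2s}$ leaves an integrable tail.\<close>

lemma pos_power_diff_bound:
  fixes c :: real
  assumes "0 < s" "0 < \<delta>" "\<delta> \<le> \<rho>" "\<bar>m\<bar> \<le> L * \<rho>" "0 \<le> L" "0 \<le> c"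
  shows "\<bar>pos_power s c - pos_power s (c + m)\<bar> \<le> (c / \<delta> + L) powr s * \<rho> powr s"
proof -
  have *: "pos_power s t \<le> ((c / \<delta> + L) * \<rho>) powr s" if "t \<le> c + \<bar>m\<bar>" for t
  proof -
    have "c \<le> c / \<delta> * \<rho>"
      using assms mult_right_mono[of \<delta> \<rho> c] by (simp add: field_simps)
    then have "c + \<bar>m\<bar> \<le> (c / \<delta> + L) * \<rho>"
      using assms by (simp add: algebra_simps)
    then have "max 0 t \<le> (c / \<delta> + L) * \<rho>"
      using that assms by auto
    then show ?thesis unfolding pos_power_def
      using assms by (intro powr_mono2) auto
  qed
  have "0 \<le> pos_power s t" for t by (simp add: pos_power_def)
  with *[of c] *[of "c + m"] have "\<bar>pos_power s c - pos_power s (c + m)\<bar> \<le> ((c / \<delta> + L) * \<rho>) powr s"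
    by (smt (verit))
  also have "\<dots> = (c / \<delta> + L) powr s * \<rho> powr s"
    by (rule powr_mult)
  finally show ?thesis .
qed

text \<open>The integrand of the fractional Laplacian of $t \mapsto t_+^s$ at the point $1$, written in the
displacement $t$ from that point.\<close>

definition pos_power_kernel :: "real \<Rightarrow> real \<Rightarrow> real" where
  "pos_power_kernel s t = (1 - pos_power s (1 + t)) * \<bar>t\<bar> powr (-1 - 2 * s)"

lemma pos_power_kernel_measurable [measurable]: "pos_power_kernel s \<in> borel_measurable borel"
  unfolding pos_power_kernel_def by measurable

lemma pos_power_kernel_integrable:
  assumes s: "0 < s" and "0 < \<delta>"
  shows "set_integrable lborel (- ball 0 \<delta>) (pos_power_kernel s)"
  unfolding set_integrable_def
proof (rule Bochner_Integration.integrable_bound)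
  show "integrable lborel (\<lambda>t::real. (1 / \<delta> + 1) powr s * (indicator (- ball 0 \<delta>) t * norm t powr (- real DIM(real) - s)))"
    by (intro integrable_mult_right integrable_power_tail assms)
  show "AE t in lborel. norm (indicator (- ball 0 \<delta>) t *\<^sub>R pos_power_kernel s t)
      \<le> norm ((1 / \<delta> + 1) powr s * (indicator (- ball 0 \<delta>) t * norm t powr (- real DIM(real) - s)))"
  proof (rule AE_I2)
    fix t :: real
    show "norm (indicator (- ball 0 \<delta>) t *\<^sub>R pos_power_kernel s t)
      \<le> norm ((1 / \<delta> + 1) powr s * (indicator (- ball 0 \<delta>) t * norm t powr (- real DIM(real) - s)))"
    proof (cases "\<delta> \<le> \<bar>t\<bar>")
      case True
      have "\<bar>1 - pos_power s (1 + t)\<bar> \<le> (1 / \<delta> + 1) powr s * \<bar>t\<bar> powr s"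
        using pos_power_diff_bound[of s \<delta> "\<bar>t\<bar>" t 1 1] True assms by (simp add: pos_power_def)
      then have "\<bar>1 - pos_power s (1 + t)\<bar> * \<bar>t\<bar> powr (-1 - 2 * s) \<le>
          (1 / \<delta> + 1) powr s * \<bar>t\<bar> powr s * \<bar>t\<bar> powr (-1 - 2 * s)"
        by (intro mult_right_mono) auto
      also have "\<dots> = (1 / \<delta> + 1) powr s * \<bar>t\<bar> powr (-1 - s)"
        by (simp add: mult.assoc powr_add[symmetric] minus_diff_commute)
      finally show ?thesis by (simp add: pos_power_kernel_def abs_mult indicator_def)
    qed (auto simp: indicator_def)
  qed
qed measurable

text \<open>With $A(r) = (1-(1-r)^s)\,r^{-1-2s}$, the displacement $-r$ contributes $A(r)$ and the displacement
$r/(1-r)$, including the Jacobian, contributes $-A(r)(1-r)^{s-1}$. Minus their sum has an elementary primitive,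
which vanishes as $r \to 0$ because $s < 1$.\<close>

lemma folded_kernel_primitive:
  assumes s: "0 < s" "s < 1" and r: "0 < r" "r < 1"
  shows "((\<lambda>r. (1 - (1 - r) powr s)\<^sup>2 * r powr (-2 * s) / (2 * s)) has_real_derivative
    - ((1 - (1 - r) powr s) * (1 - (1 - r) powr (s - 1)) * r powr (-1 - 2 * s))) (at r)"
proof -
  define p where "p = (1 - r) powr (s - 1)"
  define q where "q = r powr (-1 - 2 * s)"
  have p: "(1 - r) powr s = p * (1 - r)"
    using r powr_add[of "1 - r" "s - 1" 1] by (simp add: p_def)
  have q: "r powr (-2 * s) = q * r"
    using r powr_add[of r "-1 - 2 * s" 1] by (simp add: q_def)
  have "((\<lambda>r. (1 - (1 - r) powr s)\<^sup>2 * r powr (-2 * s) / (2 * s)) has_real_derivative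
     (2 * (1 - (1 - r) powr s) * (s * p) * r powr (-2 * s) + (1 - (1 - r) powr s)\<^sup>2 * (-2 * s * q)) / (2 * s)) (at r)"
    using r s by (auto intro!: derivative_eq_intros simp: p_def q_def field_simps minus_diff_commute)
  also have "(2 * (1 - (1 - r) powr s) * (s * p) * r powr (-2 * s) + (1 - (1 - r) powr s)\<^sup>2 * (-2 * s * q)) / (2 * s)
     = - ((1 - (1 - r) powr s) * (1 - p) * q)"
    unfolding p q using s by (simp add: field_simps power2_eq_square)
  finally show ?thesis by (simp add: p_def q_def)
qed

lemma one_minus_powr_bounds:
  fixes r s :: real
  assumes "0 \<le> r" "r < 1" "0 < s" "s < 1"
  shows "0 \<le> 1 - (1 - r) powr s" "1 - (1 - r) powr s \<le> r"
proof -
  have "(1 - r) powr s \<le> 1 powr s" using assms by (intro powr_mono2) auto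
  then show "0 \<le> 1 - (1 - r) powr s" by simp
  have "(1 - r) powr 1 \<le> (1 - r) powr s" using assms by (intro powr_mono') auto
  then show "1 - (1 - r) powr s \<le> r" using assms by simp
qed

text \<open>Displacements below $-1$ meet the zero set of $t_+^s$ and contribute exactly $1/(2s)$. The
primitive $P$ of \<open>folded_kernel_primitive\<close> has $P(1) = 1/(2s)$, so this contribution cancels and
only boundary terms near $\delta$ remain.

The inversion maps $t \ge \delta$ to $r \ge \delta' = \delta/(1+\delta)$ rather than to $r \ge \delta$. The
integral over the gap $[\delta', \delta]$, whose length is at most $\delta^2$, is the second boundary term.\<close>

lemma integral_pos_power_kernel_bound:
  assumes s: "0 < s" "s < 1" and \<delta>: "0 < \<delta>" "\<delta> \<le> 1 / 2"
  shows "\<bar>LINT t:- ball 0 \<delta>|lborel. pos_power_kernel s t\<bar> \<le> (1 / (2 * s) + 8) * \<delta> powr (2 - 2 * s)"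
proof -
  define F where "F = pos_power_kernel s"
  define A where "A r = (1 - (1 - r) powr s) * r powr (-1 - 2 * s)" for r
  define B where "B r = A r * (1 - r) powr (s - 1)" for r
  define P where "P r = (1 - (1 - r) powr s)\<^sup>2 * r powr (-2 * s) / (2 * s)" for r
  define \<delta>' where "\<delta>' = \<delta> / (1 + \<delta>)"
  have \<delta>': "0 < \<delta>'" "\<delta>' \<le> \<delta>" "\<delta> / 2 \<le> \<delta>'" "\<delta> - \<delta>' \<le> \<delta>\<^sup>2" "\<delta>' < 1"
    using \<delta> by (auto simp: \<delta>'_def field_simps power2_eq_square)
  have int: "set_integrable lborel (- ball 0 \<delta>) F"
    unfolding F_def by (intro pos_power_kernel_integrable s \<delta>)
  have intR: "set_integrable lborel {\<delta>..} F"
    by (rule set_integrable_subset[OF int]) auto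
  have intL: "set_integrable lborel {..-\<delta>} F"
    by (rule set_integrable_subset[OF int]) auto
  then have intL': "set_integrable lborel {\<delta>..} (\<lambda>r. F (- r))"
    using lborel_integrable_real_affine_iff[of "-1" "\<lambda>x. indicator {..-\<delta>} x *\<^sub>R F x" 0]
    by (simp add: set_integrable_def indicator_def)
  have "(LINT t:- ball 0 \<delta>|lborel. F t) = (LINT t:{\<delta>..} \<union> {..-\<delta>}|lborel. F t)"
    by (intro arg_cong2[where f="\<lambda>A. set_lebesgue_integral lborel A"] refl) auto
  also have "\<dots> = (LINT t:{\<delta>..}|lborel. F t) + (LINT t:{..-\<delta>}|lborel. F t)"
    using \<delta> by (intro set_integral_Un intR intL) auto
  also have "(LINT t:{..-\<delta>}|lborel. F t) = (LINT r:{\<delta>..}|lborel. F (- r))"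
    using lborel_integral_real_affine[of "-1" "\<lambda>x. indicator {..-\<delta>} x *\<^sub>R F x" 0]
    by (simp add: set_lebesgue_integral_def indicator_def)
  finally have I: "(LINT t:- ball 0 \<delta>|lborel. F t) = integral {\<delta>..} F + integral {\<delta>..} (\<lambda>r. F (- r))"
    using set_borel_integral_eq_integral(2)[OF intR] set_borel_integral_eq_integral(2)[OF intL'] by simp

  have FR: "(F has_integral integral {\<delta>..} F) {\<delta>..}"
    using set_borel_integral_eq_integral(1)[OF intR] by (rule integrable_integral)
  have FL: "((\<lambda>r. F (- r)) has_integral integral {\<delta>..} (\<lambda>r. F (- r))) {\<delta>..}"
    using set_borel_integral_eq_integral(1)[OF intL'] by (rule integrable_integral)

  \<comment> \<open>the half line where the positive part vanishes\<close>
  have tail: "((\<lambda>r. F (- r)) has_integral 1 / (2 * s)) {1..}"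
  proof -
    have "((\<lambda>r::real. r powr (-1 - 2 * s)) has_integral - (1 powr (-1 - 2 * s + 1)) / (-1 - 2 * s + 1)) {1..}"
      using s by (intro has_integral_powr_to_inf) auto
    then have "((\<lambda>r::real. r powr (-1 - 2 * s)) has_integral 1 / (2 * s)) {1..}"
      by simp
    then show ?thesis
      by (rule has_integral_eq[rotated]) (auto simp: F_def pos_power_kernel_def pos_power_def)
  qed
  have near: "((\<lambda>r. F (- r)) has_integral integral {\<delta>..1} (\<lambda>r. F (- r))) {\<delta>..1}"
    by (intro integrable_integral integrable_on_subinterval[OF has_integral_integrable[OF FL]]) auto
  have "((\<lambda>r. F (- r)) has_integral integral {\<delta>..1} (\<lambda>r. F (- r)) + 1 / (2 * s)) ({\<delta>..1} \<union> {1..})"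
    by (rule has_integral_Un[OF near tail]) (use \<delta> in \<open>auto intro: negligible_subset[of "{1}"]\<close>)
  also have "{\<delta>..1} \<union> {1..} = {\<delta>..}" using \<delta> by auto
  finally have L: "integral {\<delta>..} (\<lambda>r. F (- r)) = integral {\<delta>..1} (\<lambda>r. F (- r)) + 1 / (2 * s)"
    by (rule integral_unique)
  have nearA: "(A has_integral integral {\<delta>..1} (\<lambda>r. F (- r))) {\<delta>..1}"
    using \<delta> by (intro has_integral_eq[OF _ near])
      (auto simp: F_def A_def pos_power_kernel_def pos_power_def)

  \<comment> \<open>the inversion of the right half onto the unit interval\<close>
  have image: "(\<lambda>r. r / (1 - r)) ` {\<delta>'..<1} = {\<delta>..}"
  proof (intro equalityI subsetI)
    fix t assume "t \<in> (\<lambda>r. r / (1 - r)) ` {\<delta>'..<1}"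
    then show "t \<in> {\<delta>..}" using \<delta> by (auto simp: \<delta>'_def field_simps)
  next
    fix t assume "t \<in> {\<delta>..}"
    then have "t / (1 + t) \<in> {\<delta>'..<1}" "t = t / (1 + t) / (1 - t / (1 + t))"
      using \<delta> by (auto simp: \<delta>'_def field_simps)
    then show "t \<in> (\<lambda>r. r / (1 - r)) ` {\<delta>'..<1}" by blast
  qed
  have subst: "\<bar>1 / (1 - r)\<^sup>2\<bar> * F (r / (1 - r)) = - B r" if r: "r \<in> {\<delta>'..<1}" for r
  proof -
    have r: "0 < r" "r < 1" using r \<delta>' by auto
    then have e: "1 + r / (1 - r) = 1 / (1 - r)" by (simp add: field_simps)
    define p where "p = (1 - r) powr s"
    have p: "p > 0" using r by (simp add: p_def)
    have "F (r / (1 - r)) = (1 - 1 / p) * (r powr (-1 - 2 * s) / (1 - r) powr (-1 - 2 * s))"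
      using r unfolding F_def pos_power_kernel_def pos_power_def e p_def
      by (simp add: powr_divide)
    also have "(1 - r) powr (-1 - 2 * s) = 1 / ((1 - r) * p * p)"
    proof -
      have "(1 - r) powr (-1 - 2 * s) = (1 - r) powr (- (1 + s + s))" by (simp add: algebra_simps)
      also have "\<dots> = 1 / ((1 - r) * p * p)" using r
        unfolding powr_minus powr_add p_def by (simp add: field_simps)
      finally show ?thesis .
    qed
    finally have F: "F (r / (1 - r)) = (1 - 1 / p) * (r powr (-1 - 2 * s) * ((1 - r) * p * p))" by simp
    have B: "(1 - r) powr (s - 1) = p / (1 - r)" using r by (simp add: powr_diff p_def)
    have "1 / (q * q) * ((1 - 1 / p) * (R * (q * p * p))) = - ((1 - p) * R * (p / q))"
      if "q > 0" for q R :: real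
      using that p by (simp add: field_simps)
    from this[of "1 - r" "r powr (-1 - 2 * s)"] show ?thesis
      unfolding F B_def A_def p_def[symmetric] B
      using r by (simp add: power2_eq_square abs_mult)
  qed
  have "(\<lambda>r. \<bar>1 / (1 - r)\<^sup>2\<bar> * F (r / (1 - r))) absolutely_integrable_on {\<delta>'..<1} \<and>
      integral {\<delta>'..<1} (\<lambda>r. \<bar>1 / (1 - r)\<^sup>2\<bar> * F (r / (1 - r))) = integral {\<delta>..} F"
  proof (rule has_absolute_integral_change_of_variables_1'[where f=F and g="\<lambda>r. r / (1 - r)"
      and g'="\<lambda>r. 1 / (1 - r)\<^sup>2", THEN iffD2])
    show "F absolutely_integrable_on (\<lambda>r. r / (1 - r)) ` {\<delta>'..<1} \<and> integral ((\<lambda>r. r / (1 - r)) ` {\<delta>'..<1}) F = integral {\<delta>..} F"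
      unfolding image
    proof
      show "F absolutely_integrable_on {\<delta>..}"
        using intR unfolding set_integrable_def
        by (subst integrable_completion) (auto simp: F_def)
    qed simp
    show "((\<lambda>r. r / (1 - r)) has_real_derivative 1 / (1 - r)\<^sup>2) (at r within {\<delta>'..<1})" if "r \<in> {\<delta>'..<1}" for r
      using that by (auto intro!: derivative_eq_intros simp: field_simps power2_eq_square)
    show "inj_on (\<lambda>r. r / (1 - r)) {\<delta>'..<1}"
      by (auto simp: inj_on_def field_simps)
  qed auto
  then have "((\<lambda>r. \<bar>1 / (1 - r)\<^sup>2\<bar> * F (r / (1 - r))) has_integral integral {\<delta>..} F) {\<delta>'..<1}"
    by (metis has_integral_integral set_lebesgue_integral_eq_integral(1))
  then have "((\<lambda>r. - B r) has_integral integral {\<delta>..} F) {\<delta>'..<1}"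
    by (rule has_integral_eq[rotated]) (use subst in auto)
  from has_integral_neg[OF this] have "(B has_integral - integral {\<delta>..} F) {\<delta>'..<1}"
    by simp
  then have Bfull: "(B has_integral - integral {\<delta>..} F) {\<delta>'..1}"
    by (subst has_integral_spike_set_eq[of _ "{\<delta>'..<1}"])
      (auto intro: negligible_subset[of "{1}"])
  define b where "b = integral {\<delta>'..\<delta>} B"
  have Bnear: "(B has_integral b) {\<delta>'..\<delta>}" unfolding b_def
    using \<delta> by (intro integrable_integral integrable_on_subinterval[OF has_integral_integrable[OF Bfull]]) auto
  have Bfar: "(B has_integral - integral {\<delta>..} F - b) {\<delta>..1}"
  proof -
    have e: "- integral {\<delta>..} F - b = integral {\<delta>..1} B"
      unfolding b_def using Henstock_Kurzweil_Integration.integral_combine[OF \<delta>'(2) _ has_integral_integrable[OF Bfull]] \<delta>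
        integral_unique[OF Bfull] by simp
    show ?thesis unfolding e
      using \<delta>' by (intro integrable_integral integrable_on_subinterval[OF has_integral_integrable[OF Bfull]]) auto
  qed
  have "((\<lambda>r. A r - B r) has_integral integral {\<delta>..1} (\<lambda>r. F (- r)) - (- integral {\<delta>..} F - b)) {\<delta>..1}"
    by (rule has_integral_diff[OF nearA Bfar])
  moreover have "((\<lambda>r. A r - B r) has_integral (- P 1) - (- P \<delta>)) {\<delta>..1}"
  proof (rule fundamental_theorem_of_calculus_interior)
    have "continuous_on {\<delta>..1} (\<lambda>r. (1 - r) powr s)"
      using s by (intro continuous_on_powr' continuous_intros) auto
    moreover have "continuous_on {\<delta>..1} (\<lambda>r. r powr (-2 * s))"
      using \<delta> by (intro continuous_intros) auto
    ultimately show "continuous_on {\<delta>..1} (\<lambda>r. - P r)"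
      unfolding P_def using s by (intro continuous_on_minus continuous_on_divide continuous_on_mult
        continuous_on_power continuous_on_diff continuous_on_const) auto
    fix r assume "r \<in> {\<delta><..<1}"
    then have r: "0 < r" "r < 1" using \<delta> by auto
    have "((\<lambda>r. - P r) has_real_derivative - (- ((1 - (1 - r) powr s) * (1 - (1 - r) powr (s - 1)) * r powr (-1 - 2 * s)))) (at r)"
      unfolding P_def by (intro derivative_intros folded_kernel_primitive s r)
    also have "- (- ((1 - (1 - r) powr s) * (1 - (1 - r) powr (s - 1)) * r powr (-1 - 2 * s))) = A r - B r"
      by (simp add: A_def B_def algebra_simps)
    finally show "((\<lambda>r. - P r) has_vector_derivative A r - B r) (at r)"
      by (simp add: has_real_derivative_iff_has_vector_derivative)
  qed (use \<delta> in auto)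
  ultimately have "integral {\<delta>..1} (\<lambda>r. F (- r)) - (- integral {\<delta>..} F - b) = - P 1 + P \<delta>"
    by (auto dest: has_integral_unique)
  moreover have "P 1 = 1 / (2 * s)" using s by (simp add: P_def)
  ultimately have val: "(LINT t:- ball 0 \<delta>|lborel. F t) = P \<delta> - b"
    unfolding I L by simp

  have P: "0 \<le> P \<delta>" "P \<delta> \<le> 1 / (2 * s) * \<delta> powr (2 - 2 * s)"
  proof -
    have "(1 - (1 - \<delta>) powr s)\<^sup>2 \<le> \<delta>\<^sup>2"
      using one_minus_powr_bounds[of \<delta> s] \<delta> s by (intro power_mono) auto
    then have "P \<delta> \<le> \<delta>\<^sup>2 * \<delta> powr (-2 * s) / (2 * s)"
      unfolding P_def using s by (intro divide_right_mono mult_right_mono) auto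
    also have "\<delta>\<^sup>2 = \<delta> powr 2" using \<delta> by simp
    also have "\<delta> powr 2 * \<delta> powr (-2 * s) = \<delta> powr (2 - 2 * s)"
      by (simp add: powr_add[symmetric])
    finally show "P \<delta> \<le> 1 / (2 * s) * \<delta> powr (2 - 2 * s)" by simp
    show "0 \<le> P \<delta>" using s by (simp add: P_def)
  qed
  \<comment> \<open>the gap: the integrand is of order \<open>\<delta> powr (-2 * s)\<close> and the length of order \<open>\<delta> ^ 2\<close>\<close>
  have b: "\<bar>b\<bar> \<le> 8 * \<delta> powr (2 - 2 * s)"
  proof -
    have B_bound: "norm (B r) \<le> 2 * (\<delta> / 2) powr (-2 * s)" if "r \<in> cbox \<delta>' \<delta>" for r
    proof -
      have r: "\<delta> / 2 \<le> r" "r \<le> 1 / 2" "0 < r" using that \<delta> \<delta>' by auto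
      have "(1 - r) powr (s - 1) \<le> (1 / 2) powr (s - 1)"
        using r s by (intro powr_mono2') auto
      also have "\<dots> \<le> (1 / 2) powr (- 1)"
        using s by (intro powr_mono') auto
      finally have p: "(1 - r) powr (s - 1) \<le> 2" by (simp add: powr_minus)
      have q: "r powr (-2 * s) \<le> (\<delta> / 2) powr (-2 * s)"
        using r s \<delta> by (intro powr_mono2') auto
      have "A r \<le> r * r powr (-1 - 2 * s)"
        unfolding A_def using one_minus_powr_bounds[of r s] r s by (intro mult_right_mono) auto
      also have "\<dots> = r powr (-2 * s)"
        using r powr_add[of r 1 "-1 - 2 * s"] by simp
      finally have a: "A r \<le> (\<delta> / 2) powr (-2 * s)" using q by simp
      have a0: "0 \<le> A r"
        unfolding A_def using one_minus_powr_bounds[of r s] r s by (intro mult_nonneg_nonneg) auto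
      have "B r \<le> (\<delta> / 2) powr (-2 * s) * 2"
        unfolding B_def by (intro mult_mono a p) auto
      moreover have "0 \<le> B r" using a0 by (simp add: B_def)
      ultimately show ?thesis by simp
    qed
    have "norm b \<le> 2 * (\<delta> / 2) powr (-2 * s) * measure lborel (cbox \<delta>' \<delta>)"
      by (rule has_integral_bound[where f=B]) (use Bnear B_bound in \<open>auto simp: cbox_interval\<close>)
    also have "\<dots> \<le> 2 * (4 * \<delta> powr (-2 * s)) * \<delta>\<^sup>2"
    proof (intro mult_mono)
      have "(\<delta> / 2) powr (-2 * s) = \<delta> powr (-2 * s) * 2 powr (2 * s)"
        using \<delta> by (simp add: powr_divide powr_minus field_simps)
      also have "\<dots> \<le> \<delta> powr (-2 * s) * 2 powr 2"
        using s by (intro mult_left_mono powr_mono) auto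
      finally show "(\<delta> / 2) powr (-2 * s) \<le> 4 * \<delta> powr (-2 * s)" by simp
      show "measure lborel (cbox \<delta>' \<delta>) \<le> \<delta>\<^sup>2" using \<delta>' by simp
    qed auto
    also have "\<dots> = 8 * (\<delta> powr 2 * \<delta> powr (-2 * s))" using \<delta> by simp
    also have "\<delta> powr 2 * \<delta> powr (-2 * s) = \<delta> powr (2 - 2 * s)"
      by (simp add: powr_add[symmetric])
    finally show ?thesis by simp
  qed
  from P b show ?thesis unfolding F_def[symmetric] val by (simp add: algebra_simps)
qed

lemma powr_at_right_0:
  assumes "0 < e"
  shows "((\<lambda>h::real. h powr e) \<longlongrightarrow> 0) (at_right 0)"
  using assms tendsto_powr'[of "\<lambda>x. x" 0 "at_right (0::real)" "\<lambda>_. e" e]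
  by (auto simp: eventually_at_filter tendsto_ident_at)

lemma integral_pos_power_kernel_tendsto:
  assumes s: "0 < s" "s < 1"
  shows "((\<lambda>\<delta>. LINT t:- ball 0 \<delta>|lborel. pos_power_kernel s t) \<longlongrightarrow> 0) (at_right 0)"
proof (rule Lim_null_comparison)
  show "\<forall>\<^sub>F \<delta> in at_right 0. norm (LINT t:- ball 0 \<delta>|lborel. pos_power_kernel s t) \<le> (1 / (2 * s) + 8) * \<delta> powr (2 - 2 * s)"
    using integral_pos_power_kernel_bound[OF s] eventually_at_right_real[of 0 "1/2"]
    by (auto elim!: eventually_mono)
  have "((\<lambda>\<delta>. (1 / (2 * s) + 8) * \<delta> powr (2 - 2 * s)) \<longlongrightarrow> (1 / (2 * s) + 8) * 0) (at_right 0)"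
    using s by (intro tendsto_mult tendsto_const powr_at_right_0) auto
  then show "((\<lambda>\<delta>. (1 / (2 * s) + 8) * \<delta> powr (2 - 2 * s)) \<longlongrightarrow> 0) (at_right 0)" by simp
qed

section \<open>Powers of the positive part of an affine function\<close>

text \<open>For $\mu \ne 0$ substitute $t = \mu r$. For $\mu = 0$ the line is parallel to the level sets of the
function, and both sides vanish.\<close>

lemma integral_scaled_pos_power_kernel:
  assumes "\<rho> > 0"
  shows "(\<integral>r. indicator (- ball 0 \<rho>) r * ((1 - pos_power s (1 + \<mu> * r)) * \<bar>r\<bar> powr (-1 - 2 * s)) \<partial>lborel)
    = \<bar>\<mu>\<bar> powr (2 * s) * (LINT t:- ball 0 (\<bar>\<mu>\<bar> * \<rho>)|lborel. pos_power_kernel s t)"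
proof (cases "\<mu> = 0")
  case True
  then show ?thesis by (simp add: pos_power_def)
next
  case False
  have "(LINT t:- ball 0 (\<bar>\<mu>\<bar> * \<rho>)|lborel. pos_power_kernel s t) =
      \<bar>\<mu>\<bar> * (\<integral>r. indicator (- ball 0 (\<bar>\<mu>\<bar> * \<rho>)) (\<mu> * r) * pos_power_kernel s (\<mu> * r) \<partial>lborel)"
    unfolding set_lebesgue_integral_def 
    using lborel_integral_real_affine[OF False,
      of "\<lambda>t. indicator (- ball 0 (\<bar>\<mu>\<bar> * \<rho>)) t * pos_power_kernel s t" 0] by simp
  also have "(\<lambda>r. indicator (- ball 0 (\<bar>\<mu>\<bar> * \<rho>)) (\<mu> * r) * pos_power_kernel s (\<mu> * r)) =
      (\<lambda>r. \<bar>\<mu>\<bar> powr (-1 - 2 * s) * (indicator (- ball 0 \<rho>) r * ((1 - pos_power s (1 + \<mu> * r)) * \<bar>r\<bar> powr (-1 - 2 * s))))"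
  proof
    fix r
    have "\<bar>\<mu>\<bar> * \<rho> \<le> \<bar>\<mu> * r\<bar> \<longleftrightarrow> \<rho> \<le> \<bar>r\<bar>"
      using False by (simp add: abs_mult)
    then show "indicator (- ball 0 (\<bar>\<mu>\<bar> * \<rho>)) (\<mu> * r) * pos_power_kernel s (\<mu> * r) =
      \<bar>\<mu>\<bar> powr (-1 - 2 * s) * (indicator (- ball 0 \<rho>) r * ((1 - pos_power s (1 + \<mu> * r)) * \<bar>r\<bar> powr (-1 - 2 * s)))"
      by (simp add: indicator_def pos_power_kernel_def abs_mult powr_mult not_less[symmetric])
  qed
  also have "\<bar>\<mu>\<bar> * (\<integral>r. \<bar>\<mu>\<bar> powr (-1 - 2 * s) * (indicator (- ball 0 \<rho>) r * ((1 - pos_power s (1 + \<mu> * r)) * \<bar>r\<bar> powr (-1 - 2 * s))) \<partial>lborel)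
     = (\<bar>\<mu>\<bar> powr 1 * \<bar>\<mu>\<bar> powr (-1 - 2 * s)) * (\<integral>r. indicator (- ball 0 \<rho>) r * ((1 - pos_power s (1 + \<mu> * r)) * \<bar>r\<bar> powr (-1 - 2 * s)) \<partial>lborel)"
    by simp
  also have "\<bar>\<mu>\<bar> powr 1 * \<bar>\<mu>\<bar> powr (-1 - 2 * s) = \<bar>\<mu>\<bar> powr (- (2 * s))"
    by (simp only: powr_add[symmetric]) simp
  finally show ?thesis
    using False by (simp add: mult.assoc[symmetric] powr_add[symmetric])
qed

text \<open>The integrand of the truncated integral of $y \mapsto (p + v \cdot y)_+^s$, in the displacement $z$ from a
point at which the affine function has the value $c$.\<close>

definition ridge_kernel :: "real \<Rightarrow> real \<Rightarrow> 'a::euclidean_space \<Rightarrow> real \<Rightarrow> 'a \<Rightarrow> real" where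
  "ridge_kernel s c v \<epsilon> z = indicator (- ball 0 \<epsilon>) z *
     ((pos_power s c - pos_power s (c + v \<bullet> z)) * norm z powr (- real DIM('a) - 2 * s))"

lemma ridge_kernel_integrable:
  fixes v :: "'a::euclidean_space"
  assumes "0 < s" "0 < \<epsilon>" "0 \<le> c"
  shows "integrable lborel (ridge_kernel s c v \<epsilon>)"
proof (rule Bochner_Integration.integrable_bound)
  let ?K = "(c / \<epsilon> + norm v) powr s"
  show "integrable lborel (\<lambda>z::'a. ?K * (indicator (- ball 0 \<epsilon>) z * norm z powr (- real DIM('a) - s)))"
    by (intro integrable_mult_right integrable_power_tail assms)
  show "AE z in lborel. norm (ridge_kernel s c v \<epsilon> z)
      \<le> norm (?K * (indicator (- ball 0 \<epsilon>) z * norm z powr (- real DIM('a) - s)))"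
  proof (rule AE_I2)
    fix z :: 'a
    show "norm (ridge_kernel s c v \<epsilon> z)
      \<le> norm (?K * (indicator (- ball 0 \<epsilon>) z * norm z powr (- real DIM('a) - s)))"
    proof (cases "\<epsilon> \<le> norm z")
      case True
      have "\<bar>pos_power s c - pos_power s (c + v \<bullet> z)\<bar> \<le> ?K * norm z powr s"
        using True assms Cauchy_Schwarz_ineq2[of v z] by (intro pos_power_diff_bound) auto
      then have "\<bar>pos_power s c - pos_power s (c + v \<bullet> z)\<bar> * norm z powr (- real DIM('a) - 2 * s) \<le>
          ?K * norm z powr s * norm z powr (- real DIM('a) - 2 * s)"
        by (intro mult_right_mono) auto
      also have "\<dots> = ?K * norm z powr (- real DIM('a) - s)"
        by (simp add: mult.assoc powr_add[symmetric] minus_diff_commute)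
      finally show ?thesis by (simp add: ridge_kernel_def abs_mult indicator_def)
    qed (auto simp: indicator_def ridge_kernel_def)
  qed
  show "ridge_kernel s c v \<epsilon> \<in> borel_measurable lborel"
    unfolding ridge_kernel_def by measurable
qed

text \<open>On the line through $0$ and $w$ the integrand is a rescaling of the one-dimensional one, and the ball
of radius $\epsilon$ cuts out the interval of radius $\epsilon/|w|$.\<close>

lemma dilation_ridge_kernel:
  fixes v w :: "'a::euclidean_space"
  assumes "0 < c" "w \<in> annulus"
  shows "dilation_weight w r * ridge_kernel s c v \<epsilon> (r *\<^sub>R w) =
    (c powr s * norm w powr (- real DIM('a) - 2 * s)) *
     (indicator (- ball 0 (\<epsilon> / norm w)) r * ((1 - pos_power s (1 + (v \<bullet> w / c) * r)) * \<bar>r\<bar> powr (-1 - 2 * s)))"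
proof (cases "r = 0")
  case True
  then show ?thesis by (simp add: dilation_weight_def)
next
  case False
  have w: "norm w > 0" using assms by (auto simp: annulus_def)
  have ind: "indicator (- ball 0 \<epsilon>) (r *\<^sub>R w) = (indicator (- ball 0 (\<epsilon> / norm w)) r :: real)"
    using w by (simp add: indicator_def field_simps)
  have "pos_power s (c + v \<bullet> (r *\<^sub>R w)) = pos_power s (c * (1 + (v \<bullet> w / c) * r))"
    using assms by (simp add: algebra_simps)
  also have "\<dots> = c powr s * pos_power s (1 + (v \<bullet> w / c) * r)"
  proof -
    have "max 0 (c * t) = c * max 0 t" for t
      using assms by (simp add: max_def mult_le_0_iff zero_le_mult_iff)
    then show ?thesis by (simp add: pos_power_def powr_mult)
  qed
  finally have diff: "pos_power s c - pos_power s (c + v \<bullet> (r *\<^sub>R w)) = c powr s * (1 - pos_power s (1 + (v \<bullet> w / c) * r))"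
    using assms by (simp add: algebra_simps pos_power_def)
  have "\<bar>r\<bar> ^ DIM('a) / \<bar>r\<bar> * \<bar>r\<bar> powr (- real DIM('a) - 2 * s)
      = \<bar>r\<bar> powr real DIM('a) / \<bar>r\<bar> powr 1 * \<bar>r\<bar> powr (- real DIM('a) - 2 * s)"
    using False by (simp add: powr_realpow)
  also have "\<dots> = \<bar>r\<bar> powr (-1 - 2 * s)"
    by (simp only: powr_diff[symmetric] powr_add[symmetric]) (simp add: algebra_simps)
  finally have e: "\<bar>r\<bar> ^ DIM('a) / \<bar>r\<bar> * \<bar>r\<bar> powr (- real DIM('a) - 2 * s) = \<bar>r\<bar> powr (-1 - 2 * s)" .
  have pow: "\<bar>r\<bar> ^ DIM('a) / \<bar>r\<bar> * norm (r *\<^sub>R w) powr (- real DIM('a) - 2 * s) =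
      norm w powr (- real DIM('a) - 2 * s) * \<bar>r\<bar> powr (-1 - 2 * s)"
    unfolding norm_scaleR powr_mult mult.assoc[symmetric] e by (rule mult.commute)
  have "dilation_weight w r * ridge_kernel s c v \<epsilon> (r *\<^sub>R w) =
    indicator (- ball 0 (\<epsilon> / norm w)) r * (c powr s * (1 - pos_power s (1 + (v \<bullet> w / c) * r))) *
     (\<bar>r\<bar> ^ DIM('a) / \<bar>r\<bar> * norm (r *\<^sub>R w) powr (- real DIM('a) - 2 * s))"
    using assms unfolding ridge_kernel_def diff ind dilation_weight_def by simp
  then show ?thesis unfolding pow by (simp add: mult_ac)
qed

text \<open>The integral over the line through $w$ is a bounded multiple of a one-dimensional truncated integral with
radius at most $\epsilon|v|/c$. Hence the smallness of the latter is uniform in $w$, and it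
survives the integration over the annulus.\<close>

lemma integral_ridge_kernel_tendsto:
  fixes v :: "'a::euclidean_space"
  assumes s: "0 < s" "s < 1" and c: "0 < c"
  shows "((\<lambda>\<epsilon>. \<integral>z. ridge_kernel s c v \<epsilon> z \<partial>lborel) \<longlongrightarrow> 0) (at_right 0)"
proof -
  define T where "T \<delta> = (LINT t:- ball 0 \<delta>|lborel. pos_power_kernel s t)" for \<delta>
  define V where "V = measure lborel (annulus :: 'a set)"
  define K where "K = c powr s * (norm v / c) powr (2 * s)"
  have fin: "emeasure lborel (annulus :: 'a set) < \<infinity>"
  proof (rule le_less_trans)
    show "emeasure lborel (annulus :: 'a set) \<le> emeasure lborel (cball 0 (exp 1) :: 'a set)"
      by (intro emeasure_mono) (auto simp: annulus_def)
    show "emeasure lborel (cball 0 (exp 1) :: 'a set) < \<infinity>"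
      using emeasure_lborel_cball_finite[of "0::'a" "exp 1"] by simp
  qed
  have est: "\<bar>\<integral>z. ridge_kernel s c v \<epsilon> z \<partial>lborel\<bar> \<le> K * \<eta> * V"
    if \<epsilon>: "\<epsilon> > 0" and \<eta>: "\<eta> \<ge> 0" and T: "\<And>\<delta>. 0 < \<delta> \<Longrightarrow> \<delta> \<le> norm v / c * \<epsilon> \<Longrightarrow> \<bar>T \<delta>\<bar> \<le> \<eta>" for \<epsilon> \<eta>
  proof -
    let ?J = "\<lambda>w. \<integral>r. dilation_weight w r * ridge_kernel s c v \<epsilon> (r *\<^sub>R w) \<partial>lborel"
    have int: "integrable lborel (ridge_kernel s c v \<epsilon>)"
      using \<epsilon> s c by (intro ridge_kernel_integrable) auto
    \<comment> \<open>the factor \<open>\<bar>\<mu>\<bar> powr (2 * s)\<close> vanishes on the lines where the radius of the truncation would be 0\<close>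
    have J: "\<bar>?J w\<bar> \<le> K * \<eta> * indicator annulus w" for w
    proof (cases "w \<in> annulus")
      case w: True
      then have w1: "norm w \<ge> 1" by (simp add: annulus_def)
      define \<mu> where "\<mu> = v \<bullet> w / c"
      have \<mu>: "\<bar>\<mu>\<bar> \<le> norm v / c * norm w"
        using Cauchy_Schwarz_ineq2[of v w] c by (simp add: \<mu>_def divide_right_mono)
      have "?J w = c powr s * norm w powr (- real DIM('a) - 2 * s) *
          (\<bar>\<mu>\<bar> powr (2 * s) * T (\<bar>\<mu>\<bar> * (\<epsilon> / norm w)))"
      proof -
        have "\<epsilon> / norm w > 0" using w1 \<epsilon> by (intro divide_pos_pos) auto
        from integral_scaled_pos_power_kernel[OF this] show ?thesis
          unfolding dilation_ridge_kernel[OF c w] \<mu>_def[symmetric] T_def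
          by (simp only: integral_mult_right_zero)
      qed
      moreover have "\<bar>\<bar>\<mu>\<bar> powr (2 * s) * T (\<bar>\<mu>\<bar> * (\<epsilon> / norm w))\<bar> \<le> (norm v / c * norm w) powr (2 * s) * \<eta>"
      proof (cases "\<mu> = 0")
        case False
        have "\<bar>\<mu>\<bar> * (\<epsilon> / norm w) \<le> (norm v / c * norm w) * (\<epsilon> / norm w)"
          using \<mu> \<epsilon> by (intro mult_right_mono) auto
        also have "\<dots> = norm v / c * \<epsilon>" using w1 by (auto simp: field_simps)
        finally have "\<bar>T (\<bar>\<mu>\<bar> * (\<epsilon> / norm w))\<bar> \<le> \<eta>"
          using False \<epsilon> w1 by (intro T mult_pos_pos divide_pos_pos) auto
        then show ?thesis unfolding abs_mult
          using \<mu> s \<eta> by (intro mult_mono) (auto intro: powr_mono2)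
      qed (use \<eta> in auto)
      ultimately have "\<bar>?J w\<bar> \<le> c powr s * norm w powr (- real DIM('a) - 2 * s) * ((norm v / c * norm w) powr (2 * s) * \<eta>)"
        by (simp add: abs_mult mult_left_mono)
      also have "\<dots> = K * \<eta> * (norm w powr (- real DIM('a) - 2 * s) * norm w powr (2 * s))"
        unfolding K_def powr_mult[of "norm v / c" "norm w"] by (simp only: mult_ac)
      also have "norm w powr (- real DIM('a) - 2 * s) * norm w powr (2 * s) = norm w powr (- real DIM('a))"
        by (simp add: powr_add[symmetric])
      also have "K * \<eta> * norm w powr (- real DIM('a)) \<le> K * \<eta> * norm w powr 0"
        using w1 \<eta> by (intro mult_left_mono powr_mono) (auto simp: K_def)
      finally show ?thesis using w w1 by (auto split: if_splits)
    qed (simp add: dilation_weight_def)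
    have "2 * \<bar>\<integral>z. ridge_kernel s c v \<epsilon> z \<partial>lborel\<bar> = \<bar>\<integral>w. ?J w \<partial>lborel\<bar>"
      using integral_dilations[OF int] by simp
    also have "\<dots> \<le> (\<integral>w. \<bar>?J w\<bar> \<partial>lborel)"
      by (rule integral_abs_bound)
    also have "\<dots> \<le> (\<integral>w. K * \<eta> * indicator annulus (w::'a) \<partial>lborel)"
      by (intro integral_mono J integrable_abs integrable_integral_dilations[OF int] integrable_mult_right
          integrable_real_indicator fin) auto
    also have "\<dots> = K * \<eta> * V" by (simp add: V_def)
    finally show ?thesis by linarith
  qed
  have KV: "K * V \<ge> 0" by (simp add: K_def V_def)
  show ?thesis
  proof (rule tendstoI)
    fix e :: real assume "e > 0"
    define \<eta> where "\<eta> = e / (2 * (K * V + 1))"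
    have \<eta>: "\<eta> > 0" using \<open>e > 0\<close> KV by (simp add: \<eta>_def)
    have small: "K * \<eta> * V < e"
    proof -
      have "K * \<eta> * V = e * (K * V / (2 * (K * V + 1)))" by (simp add: \<eta>_def)
      also have "\<dots> < e * 1" using KV \<open>e > 0\<close> by (intro mult_strict_left_mono) (auto simp: field_simps)
      finally show ?thesis by simp
    qed
    have "\<forall>\<^sub>F \<delta> in at_right 0. \<bar>T \<delta>\<bar> < \<eta>"
      using tendstoD[OF integral_pos_power_kernel_tendsto[OF s] \<eta>] by (simp add: T_def dist_real_def)
    then obtain d where d: "d > 0" "\<And>\<delta>. 0 < \<delta> \<Longrightarrow> \<delta> < d \<Longrightarrow> \<bar>T \<delta>\<bar> < \<eta>"
      by (auto simp: eventually_at_right_field)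
    have "((\<lambda>\<epsilon>. norm v / c * \<epsilon>) \<longlongrightarrow> norm v / c * 0) (at_right 0)"
      by (intro tendsto_intros)
    then have "\<forall>\<^sub>F \<epsilon> in at_right 0. norm v / c * \<epsilon> < d"
      using d(1) by (intro order_tendstoD(2)) auto
    then show "\<forall>\<^sub>F \<epsilon> in at_right 0. dist (\<integral>z. ridge_kernel s c v \<epsilon> z \<partial>lborel) 0 < e"
      using eventually_at_right_less[of 0]
    proof eventually_elim
      case (elim \<epsilon>)
      have "\<bar>\<integral>z. ridge_kernel s c v \<epsilon> z \<partial>lborel\<bar> \<le> K * \<eta> * V"
        using elim \<eta> d(2) by (intro est) (auto intro: less_imp_le)
      with small show ?case by simp
    qed
  qed
qed

text \<open>This is $s$-harmonicity at one point, stated by a limit instead of the choice operator in \<open>Lim\<close>, so that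
linear combinations reduce to limits of sums.\<close>

definition principal_value_zero :: "real \<Rightarrow> (real ^ 'n::finite \<Rightarrow> real) \<Rightarrow> real ^ 'n \<Rightarrow> bool" where
  "principal_value_zero s u x \<longleftrightarrow>
     (\<forall>\<epsilon>>0. set_integrable lebesgue (- ball x \<epsilon>) (frac_kernel s u x)) \<and>
     (truncated_integral s u x \<longlongrightarrow> 0) (at_right 0)"

lemma principal_value_zero_pos_power:
  fixes v x :: "real ^ 'n::finite"
  assumes s: "0 < s" "s < 1" and c: "0 < p + v \<bullet> x"
  shows "principal_value_zero s (\<lambda>y. pos_power s (p + v \<bullet> y)) x"
proof -
  let ?u = "\<lambda>y. pos_power s (p + v \<bullet> y)"
  let ?G = "ridge_kernel s (p + v \<bullet> x) v"
  have G[measurable]: "?G \<epsilon> \<in> borel_measurable borel" for \<epsilon>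
    unfolding ridge_kernel_def by measurable
  have eq: "indicator (- ball x \<epsilon>) y *\<^sub>R frac_kernel s ?u x y = ?G \<epsilon> (- x + y)" for \<epsilon> y
  proof -
    have "indicator (- ball x \<epsilon>) y = (indicator (- ball 0 \<epsilon>) (- x + y) :: real)"
      by (simp add: indicator_def dist_norm norm_minus_commute)
    moreover have "frac_kernel s ?u x y =
        (pos_power s (p + v \<bullet> x) - pos_power s (p + v \<bullet> x + v \<bullet> (- x + y))) * norm (- x + y) powr (- real DIM(real ^ 'n) - 2 * s)"
      using powr_minus_divide[of "norm (y - x)" "real CARD('n) + 2 * s"]
      by (simp add: frac_kernel_def norm_minus_commute inner_diff_right)
    ultimately show ?thesis by (simp only: ridge_kernel_def real_scaleR_def)
  qed
  have int: "integrable lborel (\<lambda>y. ?G \<epsilon> (- x + y))" if "\<epsilon> > 0" for \<epsilon>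
  proof -
    have "integrable (distr lborel borel ((+) (- x))) (?G \<epsilon>)"
      unfolding lborel_distr_plus using that s c by (intro ridge_kernel_integrable) auto
    then show ?thesis by (subst (asm) integrable_distr_eq) auto
  qed
  have val: "truncated_integral s ?u x \<epsilon> = (\<integral>z. ?G \<epsilon> z \<partial>lborel)" for \<epsilon>
  proof -
    have "truncated_integral s ?u x \<epsilon> = (\<integral>y. ?G \<epsilon> (- x + y) \<partial>lborel)"
      unfolding truncated_integral_def set_lebesgue_integral_def eq
      by (rule integral_completion) measurable
    also have "\<dots> = (\<integral>z. ?G \<epsilon> z \<partial>distr lborel borel ((+) (- x)))"
      by (subst integral_distr) auto
    finally show ?thesis unfolding lborel_distr_plus .
  qed
  show ?thesis
    unfolding principal_value_zero_def set_integrable_def eq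
  proof (intro conjI allI impI)
    show "integrable lebesgue (\<lambda>y. ?G \<epsilon> (- x + y))" if "\<epsilon> > 0" for \<epsilon>
      using int[OF that] by (subst integrable_completion) auto
    show "(truncated_integral s ?u x \<longlongrightarrow> 0) (at_right 0)"
      unfolding val[abs_def] by (rule integral_ridge_kernel_tendsto[OF s c])
  qed
qed

lemma principal_value_zero_linear:
  assumes "principal_value_zero s u x" "principal_value_zero s v x"
  shows "principal_value_zero s (\<lambda>y. a * u y + b * v y) x"
proof -
  have eq: "frac_kernel s (\<lambda>y. a * u y + b * v y) x = (\<lambda>y. a * frac_kernel s u x y + b * frac_kernel s v x y)"
    by (auto simp: frac_kernel_def add_divide_distrib diff_divide_distrib algebra_simps)
  have int: "set_integrable lebesgue (- ball x \<epsilon>) (frac_kernel s u x)"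
    "set_integrable lebesgue (- ball x \<epsilon>) (frac_kernel s v x)" if "\<epsilon> > 0" for \<epsilon>
    using assms that by (auto simp: principal_value_zero_def)
  have "((\<lambda>\<epsilon>. a * truncated_integral s u x \<epsilon> + b * truncated_integral s v x \<epsilon>) \<longlongrightarrow> a * 0 + b * 0) (at_right 0)"
    using assms by (intro tendsto_intros) (auto simp: principal_value_zero_def)
  moreover have "\<forall>\<^sub>F \<epsilon> in at_right 0. a * truncated_integral s u x \<epsilon> + b * truncated_integral s v x \<epsilon> =
      truncated_integral s (\<lambda>y. a * u y + b * v y) x \<epsilon>"
    using eventually_at_right_less[of 0]
  proof eventually_elim
    case (elim \<epsilon>)
    show ?case unfolding truncated_integral_def eq
      using int[OF elim] by (subst set_integral_add) auto
  qed
  ultimately have "(truncated_integral s (\<lambda>y. a * u y + b * v y) x \<longlongrightarrow> 0) (at_right 0)"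
    by (simp add: filterlim_cong)
  moreover have "set_integrable lebesgue (- ball x \<epsilon>) (frac_kernel s (\<lambda>y. a * u y + b * v y) x)" if "\<epsilon> > 0" for \<epsilon>
    unfolding eq using int[OF that] by (intro set_integral_add) auto
  ultimately show ?thesis by (simp add: principal_value_zero_def)
qed

lemma s_harmonic_onI:
  assumes "u \<in> borel_measurable lebesgue" "\<And>x. x \<in> U \<Longrightarrow> principal_value_zero s u x"
  shows "s_harmonic_on s U u"
  unfolding s_harmonic_on_def
proof (intro conjI ballI assms)
  fix x assume "x \<in> U"
  from assms(2)[OF this] have pv: "principal_value_zero s u x" .
  then show "frac_laplacian_defined s u x"
    by (auto simp: principal_value_zero_def frac_laplacian_defined_def)
  have "Lim (at_right 0) (truncated_integral s u x) = 0"
    using pv by (intro tendsto_Lim) (auto simp: principal_value_zero_def)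
  then show "frac_laplacian s u x = 0" by (simp add: frac_laplacian_def)
qed

section \<open>An odd profile with a strict minimum of value zero\<close>

definition odd_power :: "real \<Rightarrow> real \<Rightarrow> real \<Rightarrow> real" where
  "odd_power s b t = pos_power s (b + t) - pos_power s (b - t)"

lemma odd_power_measurable [measurable]: "odd_power s b \<in> borel_measurable borel"
  unfolding odd_power_def by measurable

lemma odd_power_minus: "odd_power s b (- t) = - odd_power s b t"
  by (simp add: odd_power_def)

lemma principal_value_zero_odd_power:
  fixes x :: "real ^ 'n::finite"
  assumes s: "0 < s" "s < 1" and "\<bar>x $ k\<bar> < b"
  shows "principal_value_zero s (\<lambda>y. odd_power s b (y $ k)) x"
proof -
  have "principal_value_zero s (\<lambda>y. 1 * pos_power s (b + axis k 1 \<bullet> y) + (-1) * pos_power s (b + (- axis k 1) \<bullet> y)) x"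
    using assms by (intro principal_value_zero_linear principal_value_zero_pos_power)
      (auto simp: inner_axis' abs_less_iff)
  then show ?thesis by (simp add: odd_power_def inner_axis')
qed

text \<open>The first and second derivatives of \<open>odd_power s b\<close> on the interval $|t| < b$.\<close>

definition odd_power' :: "real \<Rightarrow> real \<Rightarrow> real \<Rightarrow> real" where
  "odd_power' s b t = s * ((b + t) powr (s - 1) + (b - t) powr (s - 1))"

definition odd_power'' :: "real \<Rightarrow> real \<Rightarrow> real \<Rightarrow> real" where
  "odd_power'' s b t = s * (1 - s) * ((b - t) powr (s - 2) - (b + t) powr (s - 2))"

lemma odd_power_deriv:
  assumes "\<bar>t\<bar> < b"
  shows "(odd_power s b has_real_derivative odd_power' s b t) (at t)"
proof (rule DERIV_cong_ev[THEN iffD1, OF refl _ refl])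
  show "((\<lambda>t. (b + t) powr s - (b - t) powr s) has_real_derivative odd_power' s b t) (at t)"
    using assms by (auto intro!: derivative_eq_intros simp: odd_power'_def algebra_simps)
  have "\<forall>\<^sub>F x in nhds t. x \<in> {- b<..<b}"
    using assms by (intro eventually_nhds_in_open) auto
  then show "\<forall>\<^sub>F x in nhds t. (b + x) powr s - (b - x) powr s = odd_power s b x"
    by eventually_elim (auto simp: odd_power_def pos_power_def)
qed

lemma odd_power'_deriv:
  assumes "\<bar>t\<bar> < b"
  shows "(odd_power' s b has_real_derivative odd_power'' s b t) (at t)"
proof -
  have "((\<lambda>t. s * ((b + t) powr (s - 1) + (b - t) powr (s - 1))) has_real_derivative odd_power'' s b t) (at t)"
    using assms by (auto intro!: derivative_eq_intros simp: odd_power''_def algebra_simps)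
  then show ?thesis by (simp add: odd_power'_def[abs_def])
qed

text \<open>With $b = 1 + h$, multiply by $h^{1-s}$ and let $h \to 0^+$: the first derivative tends to $s$
and the value to $0$.\<close>

lemma odd_power'_dominates:
  assumes s: "0 < s" "s < 1"
  shows "\<exists>b>1. odd_power' s b 1 + \<alpha> * odd_power s b 1 > 0"
proof -
  have "((\<lambda>h::real. s * ((2 + h) powr (s - 1) * h powr (1 - s) + 1) + \<alpha> * (((2 + h) powr s - h powr s) * h powr (1 - s)))
      \<longlongrightarrow> s * ((2 + 0) powr (s - 1) * 0 + 1) + \<alpha> * (((2 + 0) powr s - 0) * 0)) (at_right 0)"
    using s by (intro tendsto_intros powr_at_right_0) auto
  then have "\<forall>\<^sub>F h::real in at_right 0. 0 < s * ((2 + h) powr (s - 1) * h powr (1 - s) + 1) + \<alpha> * (((2 + h) powr s - h powr s) * h powr (1 - s))"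
    using s by (intro order_tendstoD(1)) auto
  then have "\<forall>\<^sub>F h::real in at_right 0. h > 0 \<and> 0 < s * ((2 + h) powr (s - 1) * h powr (1 - s) + 1) + \<alpha> * (((2 + h) powr s - h powr s) * h powr (1 - s))"
    using eventually_at_right_less[of 0] by eventually_elim auto
  then obtain h :: real where h: "h > 0" and
    pos: "0 < s * ((2 + h) powr (s - 1) * h powr (1 - s) + 1) + \<alpha> * (((2 + h) powr s - h powr s) * h powr (1 - s))"
    using eventually_happens by force
  have "h powr (s - 1) * h powr (1 - s) = 1" using h by (simp add: powr_add[symmetric])
  then have "s * ((2 + h) powr (s - 1) * h powr (1 - s) + 1) + \<alpha> * (((2 + h) powr s - h powr s) * h powr (1 - s))
     = (odd_power' s (1 + h) 1 + \<alpha> * odd_power s (1 + h) 1) * h powr (1 - s)"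
    using h by (simp add: odd_power'_def odd_power_def pos_power_def algebra_simps)
  then show ?thesis using pos h by (intro exI[of _ "1 + h"]) (simp add: zero_less_mult_iff)
qed

text \<open>With $b = 1 + h$, multiply by $h^{2-s}$ and let $h \to 0^+$: the second derivative tends to $s(1-s)$,
the lower ones to $0$.\<close>

lemma odd_power''_dominates:
  assumes s: "0 < s" "s < 1"
  shows "\<exists>b>1. odd_power'' s b 1 + \<beta> * odd_power' s b 1 + \<alpha> * odd_power s b 1 > 0"
proof -
  let ?f = "\<lambda>h::real. s * (1 - s) * (1 - (2 + h) powr (s - 2) * h powr (2 - s)) +
      \<beta> * (s * ((2 + h) powr (s - 1) * h powr (2 - s) + h)) + \<alpha> * (((2 + h) powr s - h powr s) * h powr (2 - s))"
  have "(?f \<longlongrightarrow> s * (1 - s) * (1 - (2 + 0) powr (s - 2) * 0) +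
      \<beta> * (s * ((2 + 0) powr (s - 1) * 0 + 0)) + \<alpha> * (((2 + 0) powr s - 0) * 0)) (at_right 0)"
    using s by (intro tendsto_intros powr_at_right_0) auto
  from order_tendstoD(1)[OF this, of 0] have "\<forall>\<^sub>F h in at_right 0. 0 < ?f h"
    using s by simp
  then have "\<forall>\<^sub>F h in at_right 0. h > 0 \<and> 0 < ?f h"
    using eventually_at_right_less[of 0] by eventually_elim auto
  then obtain h :: real where h: "h > 0" and pos: "0 < ?f h"
    using eventually_happens by force
  have e2: "h powr (s - 2) * h powr (2 - s) = 1" using h by (simp add: powr_add[symmetric])
  have e1: "h powr (s - 1) * h powr (2 - s) = h" using h by (simp add: powr_add[symmetric])
  have "(odd_power'' s (1 + h) 1 + \<beta> * odd_power' s (1 + h) 1 + \<alpha> * odd_power s (1 + h) 1) * h powr (2 - s) =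
     s * (1 - s) * (h powr (s - 2) * h powr (2 - s) - (2 + h) powr (s - 2) * h powr (2 - s)) +
      \<beta> * (s * ((2 + h) powr (s - 1) * h powr (2 - s) + h powr (s - 1) * h powr (2 - s))) + \<alpha> * (((2 + h) powr s - h powr s) * h powr (2 - s))"
    using h by (simp add: odd_power''_def odd_power'_def odd_power_def pos_power_def algebra_simps)
  also have "\<dots> = ?f h" unfolding e1 e2 ..
  finally have eq: "(odd_power'' s (1 + h) 1 + \<beta> * odd_power' s (1 + h) 1 + \<alpha> * odd_power s (1 + h) 1) *
      h powr (2 - s) = ?f h" .
  from pos[folded eq] have "odd_power'' s (1 + h) 1 + \<beta> * odd_power' s (1 + h) 1 + \<alpha> * odd_power s (1 + h) 1 > 0"
    by (simp add: zero_less_mult_iff)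
  then show ?thesis using h by (intro exI[of _ "1 + h"]) simp
qed

text \<open>Gaussian elimination on the jets (value, slope, second derivative) at $1$, with pivots made nonzero by
moving $b$ towards $1$. The first function is the one with $b = 2$.\<close>

lemma odd_power_combination:
  assumes s: "0 < s" "s < 1"
  obtains b c d \<alpha> \<beta> :: real where "b > 1" "c > 1" "d > 1"
    "\<alpha> * odd_power s b 1 + \<beta> * odd_power s c 1 + odd_power s d 1 = 0"
    "\<alpha> * odd_power' s b 1 + \<beta> * odd_power' s c 1 + odd_power' s d 1 = 0"
    "\<alpha> * odd_power'' s b 1 + \<beta> * odd_power'' s c 1 + odd_power'' s d 1 > 0"
proof -
  define p q r where "p = odd_power s 2 1" and "q = odd_power' s 2 1" and "r = odd_power'' s 2 1"
  have "(1::real) powr s < 3 powr s" using s by (intro powr_less_mono2) auto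
  then have p: "p > 0" by (simp add: p_def odd_power_def pos_power_def)
  \<comment> \<open>after elimination of the value, the slope of the second function is still positive\<close>
  obtain c where c: "c > 1" and pos: "odd_power' s c 1 + - (q / p) * odd_power s c 1 > 0"
    using odd_power'_dominates[OF s] by blast
  define \<rho> where "\<rho> = odd_power' s c 1 - q / p * odd_power s c 1"
  have \<rho>: "\<rho> > 0" using pos by (simp add: \<rho>_def)
  define m where "m = (odd_power'' s c 1 - r / p * odd_power s c 1) / \<rho>"
  \<comment> \<open>after elimination of value and slope, the third function keeps a positive second derivative\<close>
  obtain d where d: "d > 1" and
    pos2: "odd_power'' s d 1 + - m * odd_power' s d 1 + (m * q / p - r / p) * odd_power s d 1 > 0"
    using odd_power''_dominates[OF s] by blast
  define \<beta> where "\<beta> = - (odd_power' s d 1 - q / p * odd_power s d 1) / \<rho>"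
  define \<alpha> where "\<alpha> = - (\<beta> * odd_power s c 1 + odd_power s d 1) / p"
  have 0: "\<alpha> * p + \<beta> * odd_power s c 1 + odd_power s d 1 = 0"
    using p by (simp add: \<alpha>_def)
  have "\<alpha> * q + \<beta> * odd_power' s c 1 + odd_power' s d 1 = \<beta> * \<rho> + (odd_power' s d 1 - q / p * odd_power s d 1)"
    using p by (simp add: \<alpha>_def \<rho>_def field_simps)
  also have "\<dots> = 0" using \<rho> by (simp add: \<beta>_def)
  finally have 1: "\<alpha> * q + \<beta> * odd_power' s c 1 + odd_power' s d 1 = 0" .
  have "\<alpha> * r + \<beta> * odd_power'' s c 1 + odd_power'' s d 1 =
     odd_power'' s d 1 - r / p * odd_power s d 1 + \<beta> * (m * \<rho>)"
    using p \<rho> by (simp add: \<alpha>_def m_def field_simps)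
  also have "\<beta> * (m * \<rho>) = - m * (odd_power' s d 1 - q / p * odd_power s d 1)"
    using \<rho> by (simp add: \<beta>_def) (simp add: algebra_simps)
  finally have 2: "\<alpha> * r + \<beta> * odd_power'' s c 1 + odd_power'' s d 1 > 0"
    using pos2 by (simp add: algebra_simps)
  show ?thesis
    by (rule that[of 2 c d \<alpha> \<beta>]) (use c d 0 1 2 in \<open>auto simp: p_def q_def r_def\<close>)
qed

lemma strict_local_min_second_derivative:
  fixes f f' :: "real \<Rightarrow> real"
  assumes e: "e > 0" and f: "\<And>x. \<bar>x - a\<bar> < e \<Longrightarrow> (f has_real_derivative f' x) (at x)"
    and f': "(f' has_real_derivative l) (at a)" "f' a = 0" "l > 0"
  obtains d where "d > 0" "d \<le> e" "\<And>x. \<bar>x - a\<bar> < d \<Longrightarrow> x \<noteq> a \<Longrightarrow> f a < f x"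
proof -
  obtain d1 where d1: "d1 > 0" "\<And>h. 0 < h \<Longrightarrow> h < d1 \<Longrightarrow> f' (a + h) > 0"
    using DERIV_pos_inc_right[OF f'(1,3)] f'(2) by auto
  obtain d2 where d2: "d2 > 0" "\<And>h. 0 < h \<Longrightarrow> h < d2 \<Longrightarrow> f' (a - h) < 0"
    using DERIV_pos_inc_left[OF f'(1,3)] f'(2) by auto
  define d where "d = min e (min d1 d2)"
  have cont: "continuous_on {x..y} f" if "\<bar>x - a\<bar> < d" "\<bar>y - a\<bar> < d" for x y
    using that by (intro continuous_at_imp_continuous_on ballI DERIV_isCont[OF f]) (auto simp: d_def)
  have "f a < f x" if x: "\<bar>x - a\<bar> < d" "x \<noteq> a" for x
  proof (cases "x > a")
    case True
    show ?thesis
    proof (rule DERIV_pos_imp_increasing_open[OF True])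
      fix y assume y: "a < y" "y < x"
      then have "\<bar>y - a\<bar> < e" "f' y > 0" using x d1(2)[of "y - a"] by (auto simp: d_def)
      then show "\<exists>z. (f has_real_derivative z) (at y) \<and> z > 0" using f by blast
    qed (use x e d1 d2 in \<open>auto intro!: cont simp: d_def\<close>)
  next
    case False
    then have "x < a" using x by simp
    then show ?thesis
    proof (rule DERIV_neg_imp_decreasing_open)
      fix y assume y: "x < y" "y < a"
      then have "\<bar>y - a\<bar> < e" "f' y < 0" using x d2(2)[of "a - y"] by (auto simp: d_def)
      then show "\<exists>z. (f has_real_derivative z) (at y) \<and> z < 0" using f by blast
    qed (use x e d1 d2 in \<open>auto intro!: cont simp: d_def\<close>)
  qed
  then show ?thesis using that[of d] e d1 d2 by (auto simp: d_def)
qed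

text \<open>The radius $d$ is at most 1, which keeps the ball in the half space, and at most $b - 1$ for each of
the three parameters $b$, which keeps it in all strips of harmonicity.\<close>

theorem corollary1p2:
  fixes s :: real and k :: "'n::finite"
  assumes "0 < s" and "s < 1"
  shows "\<exists>(\<Omega> :: (real ^ 'n) set) \<Omega>'.
           bounded \<Omega> \<and> open \<Omega> \<and> \<Omega> \<subseteq> half_space k \<and> compactly_contained \<Omega>' \<Omega> \<and>
           (\<forall>C::real. C > 0 \<longrightarrow>
              (\<exists>u :: real ^ 'n \<Rightarrow> real.
                 antisymmetric k u \<and> (\<forall>x\<in>\<Omega>. u x \<ge> 0) \<and> s_harmonic_on s \<Omega> u \<and>
                 (SUP x\<in>\<Omega>'. ereal (u x)) > ereal C * (INF x\<in>\<Omega>'. ereal (u x))))"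
proof -
  obtain b1 b2 b3 \<alpha> \<beta> where b: "b1 > 1" "b2 > 1" "b3 > 1" and
    val: "\<alpha> * odd_power s b1 1 + \<beta> * odd_power s b2 1 + odd_power s b3 1 = 0"
    "\<alpha> * odd_power' s b1 1 + \<beta> * odd_power' s b2 1 + odd_power' s b3 1 = 0"
    "\<alpha> * odd_power'' s b1 1 + \<beta> * odd_power'' s b2 1 + odd_power'' s b3 1 > 0"
    using odd_power_combination[OF assms] by blast
  define f where "f t = \<alpha> * odd_power s b1 t + \<beta> * odd_power s b2 t + odd_power s b3 t" for t
  define f' where "f' t = \<alpha> * odd_power' s b1 t + \<beta> * odd_power' s b2 t + odd_power' s b3 t" for t
  define e where "e = min 1 (min (b1 - 1) (min (b2 - 1) (b3 - 1)))"
  have e: "e > 0" using b by (simp add: e_def)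
  have f: "(f has_real_derivative f' t) (at t)" if "\<bar>t - 1\<bar> < e" for t
    unfolding f_def f'_def using that
    by (intro DERIV_add DERIV_cmult odd_power_deriv) (auto simp: e_def)
  have f1: "f 1 = 0" using val by (simp add: f_def)
  have f'1: "(f' has_real_derivative \<alpha> * odd_power'' s b1 1 + \<beta> * odd_power'' s b2 1 + odd_power'' s b3 1) (at 1)"
    unfolding f'_def using b by (intro DERIV_add DERIV_cmult odd_power'_deriv) auto
  obtain d where d: "d > 0" "d \<le> e" and min: "\<And>t. \<bar>t - 1\<bar> < d \<Longrightarrow> t \<noteq> 1 \<Longrightarrow> f 1 < f t"
    by (rule strict_local_min_second_derivative[OF e f f'1]) (use val in \<open>auto simp: f'_def\<close>)
  define p :: "real ^ 'n" where "p = axis k 1"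
  define u :: "real ^ 'n \<Rightarrow> real" where "u y = f (y $ k)" for y
  have pk: "p $ k = 1" by (simp add: p_def)
  have near: "\<bar>y $ k - 1\<bar> < d" if "y \<in> ball p d" for y
    using that component_le_norm_cart[of "y - p" k] pk by (auto simp: dist_norm norm_minus_commute)
  have nonneg: "u y \<ge> 0" if "y \<in> ball p d" for y
    using min[OF near[OF that]] f1 by (cases "y $ k = 1") (auto simp: u_def)
  have "principal_value_zero s u x" if "x \<in> ball p d" for x
  proof -
    have "\<bar>x $ k\<bar> < b1" "\<bar>x $ k\<bar> < b2" "\<bar>x $ k\<bar> < b3"
      using near[OF that] d(2) by (auto simp: e_def)
    then have "principal_value_zero s (\<lambda>y. \<alpha> * odd_power s b1 (y $ k) + \<beta> * odd_power s b2 (y $ k)) x"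
      "principal_value_zero s (\<lambda>y. odd_power s b3 (y $ k)) x"
      using assms by (auto intro!: principal_value_zero_linear principal_value_zero_odd_power)
    from principal_value_zero_linear[OF this, of 1 1] show ?thesis
      by (simp add: u_def[abs_def] f_def)
  qed
  moreover have "u \<in> borel_measurable lebesgue"
  proof -
    have "u \<in> borel_measurable borel" unfolding u_def f_def by measurable
    then show ?thesis by (simp add: measurable_completion)
  qed
  ultimately have harmonic: "s_harmonic_on s (ball p d) u" by (intro s_harmonic_onI)
  have anti: "antisymmetric k u"
    by (simp add: antisymmetric_def reflect_def u_def f_def odd_power_minus)
  have inf: "(INF x\<in>ball p (d / 2). ereal (u x)) = 0"
  proof (rule antisym)
    have "p \<in> ball p (d / 2)" using d by simp
    then have "(INF x\<in>ball p (d / 2). ereal (u x)) \<le> ereal (u p)" by (rule INF_lower)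
    also have "u p = 0" using f1 pk by (simp add: u_def)
    finally show "(INF x\<in>ball p (d / 2). ereal (u x)) \<le> 0" by (simp only: zero_ereal_def)
    show "0 \<le> (INF x\<in>ball p (d / 2). ereal (u x))"
      using nonneg d by (intro INF_greatest) auto
  qed
  have sup: "(SUP x\<in>ball p (d / 2). ereal (u x)) > 0"
  proof -
    define q where "q = (1 + d / 4) *\<^sub>R p"
    have "q \<in> ball p (d / 2)"
      using d by (simp add: q_def dist_norm algebra_simps p_def)
    then have "ereal (u q) \<le> (SUP x\<in>ball p (d / 2). ereal (u x))" by (rule SUP_upper)
    moreover have "u q > 0" using min[of "1 + d / 4"] d f1 pk by (simp add: u_def q_def)
    ultimately show ?thesis by (metis ereal_less(2) less_le_trans)
  qed
  have half: "ball p d \<subseteq> half_space k"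
    using near d(2) by (force simp: half_space_def e_def abs_less_iff)
  have cc: "compactly_contained (ball p (d / 2)) (ball p d)"
    using d by (auto simp: compactly_contained_def closure_ball)
  show ?thesis
    using anti nonneg harmonic inf sup half cc
    by (intro exI[of _ "ball p d"] exI[of _ "ball p (d / 2)"]) auto
qed

end
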